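(* Let $M_1,\dots,M_{d/2+1}$ be orthonormal bases of $\mathbb R^d$ such that $\langle x,y\rangle=\pm1/\sqrt d$ whenever $x,y$ lie in different bases (a maximal real MUB), and let $X=\bigcup_{i=1}^{d/2+1}(M_i\cup(-M_i))\subset S^{d-1}$. Fix $p\in X$ and for $\alpha_1=1/\sqrt d$, $\alpha_2=0$, $\alpha_3=-1/\sqrt d$ let $X_k=\{(x-\alpha_kp)/\sqrt{1-\alpha_k^2}: x\in X,\ \langle x,p\rangle=\alpha_k\}$, a subset of the unit sphere of $p^\perp\cong\mathbb R^{d-1}$ (the derived codes of $X$ relative to $p$). Then the disjoint union $X_1\sqcup X_2\sqcup X_3$, with the relations $\{(x,x):x\in X_i\}$ ($1\le i\le 3$) and $\{(x,y)\in X_i\times X_j: x\neq y,\ \langle x,y\rangle=\alpha\}$ for each $1\le i,j\le 3$ and each value $\alpha$ attained, is a $Q$-polynomial coherent configuration.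
   Context: Coherent configuration: pair $(Y,\mathcal R)$, $\mathcal R$ a partition of $Y\times Y$ into nonempty relations, closed under transpose, each relation meeting the diagonal contained in it, and $|\{z:(x,z)\in R,(z,y)\in R'\}|$ constant on each relation $R''$. Its fibers $Y_i$ are given by the diagonal relations; relations in $Y_i\times Y_j$ are labelled $R^{(i,j)}_\ell$, $\varepsilon_{i,j}\le\ell\le r_{i,j}$ ($\varepsilon_{i,j}=1-\delta_{i,j}$, $R^{(i,i)}_0$ diagonal, $(R^{(i,j)}_\ell)^\top=R^{(j,i)}_\ell$), $\tilde r_{i,j}=r_{i,j}-\varepsilon_{i,j}$, $A^{(i,j)}_\ell$ adjacency matrices, $\mathcal A^{(i,j)}$ their span, $\mathcal A$ the span of all. It is a $Q$-polynomial coherent configuration if each fiber is a symmetric association scheme and there is a basis $\{E^{(i,j)}_\ell: 0\le\ell\le\tilde r_{i,j}\}$ of $\mathcal A$ with (B1) $E^{(i,j)}_0=\frac{1}{\sqrt{|Y_i||Y_j|}}\times$(all-ones on $Y_i\times Y_j$, zero elsewhere); (B2) $\{E^{(i,j)}_\ell\}_\ell$ is a basis of $\mathcal A^{(i,j)}$; (B3) $(E^{(i,j)}_\ell)^\top=E^{(j,i)}_\ell$; (B4) $E^{(i,j)}_\ell E^{(i',j')}_{\ell'}=\delta_{\ell,\ell'}\delta_{j,i'}E^{(i,j')}_\ell$; and such that for all $i,j$ there are polynomials $v^{(i,j)}_h$ of degree $h$ ($0\le h\le\tilde r_{i,j}$) with $\sqrt{|Y_i||Y_j|}E^{(i,j)}_h=v^{(i,j)}_h(\sqrt{|Y_i||Y_j|}E^{(i,j)}_1)$,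 the polynomial evaluated with the entrywise product (zeroth power = all-ones matrix on $Y_i\times Y_j$). *)

theory Defs
  imports "HOL-Analysis.Analysis" "HOL-Computational_Algebra.Polynomial"
    "HOL-Library.Function_Algebras"
begin

section \<open>Coherent configurations\<close>

definition coherent_configuration :: "'a set \<Rightarrow> 'a rel set \<Rightarrow> bool" where
  "coherent_configuration Y \<R> \<longleftrightarrow>
     finite Y \<and>
     \<Union>\<R> = Y \<times> Y \<and> pairwise disjnt \<R> \<and> {} \<notin> \<R> \<and>
     (\<forall>R\<in>\<R>. R\<inverse> \<in> \<R>) \<and>
     (\<forall>R\<in>\<R>. R \<inter> Id_on Y \<noteq> {} \<longrightarrow> R \<subseteq> Id_on Y) \<and>
     (\<forall>R\<in>\<R>. \<forall>R'\<in>\<R>. \<forall>R''\<in>\<R>. \<exists>n::nat. \<forall>(x, y)\<in>R''.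
        card {z. (x, z) \<in> R \<and> (z, y) \<in> R'} = n)"

definition symmetric_association_scheme :: "'a set \<Rightarrow> 'a rel set \<Rightarrow> bool" where
  "symmetric_association_scheme Y \<R> \<longleftrightarrow>
     coherent_configuration Y \<R> \<and> Id_on Y \<in> \<R> \<and> (\<forall>R\<in>\<R>. sym R)"

definition fibers :: "'a rel set \<Rightarrow> 'a set set" where
  "fibers \<R> = {F. Id_on F \<in> \<R>}"

definition block_rels :: "'a rel set \<Rightarrow> 'a set \<Rightarrow> 'a set \<Rightarrow> 'a rel set" where
  "block_rels \<R> F G = {R\<in>\<R>. R \<subseteq> F \<times> G}"

text \<open>The relations in \<open>F \<times> G\<close> are numbered from \<open>0\<close> to \<open>r\<close> if \<open>F = G\<close> (\<open>0\<close> being the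
  diagonal) and from \<open>1\<close> to \<open>r\<close> otherwise.  Reducing \<open>r\<close> by the first label gives the number
  of relations minus one in both cases.\<close>

definition rtilde :: "'a rel set \<Rightarrow> 'a set \<Rightarrow> 'a set \<Rightarrow> nat" where
  "rtilde \<R> F G = card (block_rels \<R> F G) - 1"

section \<open>Matrices indexed by the points\<close>

text \<open>A matrix is a function of its row and column index, vanishing outside \<open>Y \<times> Y\<close>
  in all uses below.\<close>

type_synonym 'a rmat = "'a \<Rightarrow> 'a \<Rightarrow> real"

definition mscale :: "real \<Rightarrow> 'a rmat \<Rightarrow> 'a rmat" where
  "mscale c A = (\<lambda>x y. c * A x y)"

lemma vector_space_mscale: "vector_space mscale"
  by unfold_locales (auto simp: mscale_def fun_eq_iff algebra_simps)

definition mmult :: "'a set \<Rightarrow> 'a rmat \<Rightarrow> 'a rmat \<Rightarrow> 'a rmat" where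
  "mmult Y A B = (\<lambda>x y. \<Sum>z\<in>Y. A x z * B z y)"

definition mtranspose :: "'a rmat \<Rightarrow> 'a rmat" where
  "mtranspose A = (\<lambda>x y. A y x)"

definition adj :: "'a rel \<Rightarrow> 'a rmat" where
  "adj R = (\<lambda>x y. of_bool ((x, y) \<in> R))"

definition mspan :: "'a rmat set \<Rightarrow> 'a rmat set" where
  "mspan = module.span mscale"

definition mbasis :: "('i \<Rightarrow> 'a rmat) \<Rightarrow> 'i set \<Rightarrow> 'a rmat set \<Rightarrow> bool" where
  "mbasis e I V \<longleftrightarrow>
     inj_on e I \<and> \<not> module.dependent mscale (e ` I) \<and> mspan (e ` I) = V"

text \<open>Evaluation of a polynomial at a matrix supported on \<open>F \<times> G\<close>, with respect to the entrywise
  product.  The unit of this product is the all-ones matrix on \<open>F \<times> G\<close>, so the constant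
  term contributes nothing outside \<open>F \<times> G\<close>.\<close>

definition entrywise_poly :: "'a set \<Rightarrow> 'a set \<Rightarrow> real poly \<Rightarrow> 'a rmat \<Rightarrow> 'a rmat" where
  "entrywise_poly F G v A = (\<lambda>x y. if x \<in> F \<and> y \<in> G then poly v (A x y) else 0)"

section \<open>The Q-polynomial property\<close>

text \<open>In the fourth clause, the condition \<open>l \<le> rtilde \<R> F G'\<close> says that the matrix
  \<open>E F G' l\<close> on the right-hand side is one of the basis matrices.\<close>

definition idempotent_type_basis ::
    "'a set \<Rightarrow> 'a rel set \<Rightarrow> ('a set \<Rightarrow> 'a set \<Rightarrow> nat \<Rightarrow> 'a rmat) \<Rightarrow> bool" where
  "idempotent_type_basis Y \<R> E \<longleftrightarrow>
     mbasis (\<lambda>(F, G, l). E F G l)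
       {(F, G, l). F \<in> fibers \<R> \<and> G \<in> fibers \<R> \<and> l \<le> rtilde \<R> F G} (mspan (adj ` \<R>)) \<and>
     (\<forall>F\<in>fibers \<R>. \<forall>G\<in>fibers \<R>.
        E F G 0 = mscale (1 / sqrt (real (card F) * real (card G))) (adj (F \<times> G))) \<and>
     (\<forall>F\<in>fibers \<R>. \<forall>G\<in>fibers \<R>.
        mbasis (E F G) {..rtilde \<R> F G} (mspan (adj ` block_rels \<R> F G))) \<and>
     (\<forall>F\<in>fibers \<R>. \<forall>G\<in>fibers \<R>. \<forall>l\<le>rtilde \<R> F G. mtranspose (E F G l) = E G F l) \<and>
     (\<forall>F\<in>fibers \<R>. \<forall>G\<in>fibers \<R>. \<forall>F'\<in>fibers \<R>. \<forall>G'\<in>fibers \<R>.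
        \<forall>l\<le>rtilde \<R> F G. \<forall>l'\<le>rtilde \<R> F' G'.
          if l = l' \<and> G = F'
          then l \<le> rtilde \<R> F G' \<and> mmult Y (E F G l) (E F' G' l') = E F G' l
          else mmult Y (E F G l) (E F' G' l') = 0)"

definition Q_polynomial_coherent_configuration :: "'a set \<Rightarrow> 'a rel set \<Rightarrow> bool" where
  "Q_polynomial_coherent_configuration Y \<R> \<longleftrightarrow>
     coherent_configuration Y \<R> \<and>
     (\<forall>F\<in>fibers \<R>. symmetric_association_scheme F (block_rels \<R> F F)) \<and>
     (\<exists>E. idempotent_type_basis Y \<R> E \<and>
        (\<forall>F\<in>fibers \<R>. \<forall>G\<in>fibers \<R>. \<exists>v :: nat \<Rightarrow> real poly. \<forall>h\<le>rtilde \<R> F G.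
           degree (v h) = h \<and>
           mscale (sqrt (real (card F) * real (card G))) (E F G h) =
             entrywise_poly F G (v h) (mscale (sqrt (real (card F) * real (card G))) (E F G 1))))"

section \<open>Maximal real MUBs and derived codes\<close>

definition orthonormal_basis :: "(real ^ 'n) set \<Rightarrow> bool" where
  "orthonormal_basis B \<longleftrightarrow>
     pairwise orthogonal B \<and> (\<forall>x\<in>B. norm x = 1) \<and> independent B \<and> span B = UNIV"

definition maximal_real_MUB :: "(nat \<Rightarrow> (real ^ 'n) set) \<Rightarrow> bool" where
  "maximal_real_MUB M \<longleftrightarrow>
     even CARD('n) \<and>
     (\<forall>i\<in>{1..CARD('n) div 2 + 1}. orthonormal_basis (M i)) \<and>
     (\<forall>i\<in>{1..CARD('n) div 2 + 1}. \<forall>j\<in>{1..CARD('n) div 2 + 1}. i \<noteq> j \<longrightarrow>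
        (\<forall>x\<in>M i. \<forall>y\<in>M j. x \<bullet> y = 1 / sqrt CARD('n) \<or> x \<bullet> y = - 1 / sqrt CARD('n)))"

definition MUB_code :: "(nat \<Rightarrow> (real ^ 'n) set) \<Rightarrow> (real ^ 'n) set" where
  "MUB_code M = (\<Union>i\<in>{1..CARD('n) div 2 + 1}. M i \<union> uminus ` M i)"

definition derived_code :: "'v::real_inner set \<Rightarrow> 'v \<Rightarrow> real \<Rightarrow> 'v set" where
  "derived_code X p a = {(x - a *\<^sub>R p) /\<^sub>R sqrt (1 - a\<^sup>2) | x. x \<in> X \<and> x \<bullet> p = a}"

text \<open>Derived codes with different indices may share points (for \<open>d = 4\<close> the first and the
  third are the same cube), so the disjoint union is taken with tags.  Points with different tags
  are distinct, even if their second components agree.\<close>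

definition tagged_union :: "'k set \<Rightarrow> ('k \<Rightarrow> 'v set) \<Rightarrow> ('k \<times> 'v) set" where
  "tagged_union K X = Sigma K X"

definition inner_rel :: "('k \<Rightarrow> 'v::real_inner set) \<Rightarrow> 'k \<Rightarrow> 'k \<Rightarrow> real \<Rightarrow> ('k \<times> 'v) rel" where
  "inner_rel X i j a =
     {((i, x), (j, y)) | x y. x \<in> X i \<and> y \<in> X j \<and> (i, x) \<noteq> (j, y) \<and> x \<bullet> y = a}"

definition inner_rels :: "'k set \<Rightarrow> ('k \<Rightarrow> 'v::real_inner set) \<Rightarrow> ('k \<times> 'v) rel set" where
  "inner_rels K X =
     {{((i, x), (i, x)) | x. x \<in> X i} | i. i \<in> K} \<union>
     {inner_rel X i j a | i j a. i \<in> K \<and> j \<in> K \<and>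
        (\<exists>x\<in>X i. \<exists>y\<in>X j. (i, x) \<noteq> (j, y) \<and> x \<bullet> y = a)}"

end

theory Submission
  imports Defs
begin

text \<open>
  Suppose that for every pair of codes \<open>X i\<close>, \<open>X j\<close> with \<open>r + 1\<close> mutual inner products there are
  polynomials \<open>V i j l\<close> of degree \<open>l\<close>, for \<open>l \<le> r\<close>, whose kernels \<open>V i j l (x \<bullet> z)\<close> multiply like
  matrix units up to the factor \<open>card (X j)\<close>.  Polynomials of degree at most \<open>r\<close> represent every
  function of the \<open>r + 1\<close> inner products uniquely, so the kernels span the adjacency matrices of
  each block; their multiplication rule then yields the intersection numbers, and the normalised
  kernels are the basis required by the Q-polynomial property.

  For a maximal MUB with \<open>p\<close> in one of the bases, each of the other \<open>d / 2\<close> bases, with signs chosen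
  so that all inner products with \<open>p\<close> are positive, projects to a regular simplex in the
  complement of \<open>p\<close>.  The first derived code is the union of these simplices, the third is
  its negative, and the second is a cross polytope.  All three are spherical 2-designs, which
  settles the kernels of degree at most one; the remaining kernels are combinations of the
  relations "equal" and "in the same simplex" (or "equal up to sign") with those of degree at most one.
\<close>

section \<open>Bases of polynomials and of matrices\<close>

interpretation mat: vector_space mscale
  by (rule vector_space_mscale)

text \<open>Elimination from the top degree. The condition on \<open>V 0\<close> is separate because
  the zero polynomial also has \<open>degree\<close> 0.\<close>

lemma poly_basis_expand:
  fixes V :: "nat \<Rightarrow> 'a::field poly"
  assumes "\<And>h. h \<le> r \<Longrightarrow> degree (V h) = h" "V 0 \<noteq> 0" "degree q \<le> r"
  shows "\<exists>c. q = (\<Sum>h\<le>r. smult (c h) (V h))"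
  using assms
proof (induction r arbitrary: q)
  case 0
  then obtain a b where ab: "q = [:a:]" "V 0 = [:b:]" "b \<noteq> 0"
    by (metis degree_eq_zeroE le_zero_eq order_refl pCons_0_0)
  have "q = (\<Sum>h\<le>0. smult (a / b) (V h))"
    using ab by simp
  then show ?case by (rule exI[of _ "\<lambda>_. a / b"])
next
  case (Suc r)
  \<comment> \<open>Cancels the coefficient at \<open>Suc r\<close>; if \<open>q\<close> already has
    smaller degree, \<open>k\<close> is 0.\<close>
  define k where "k = coeff q (Suc r) / lead_coeff (V (Suc r))"
  have deg: "degree (V (Suc r)) = Suc r" using Suc.prems by simp
  have "lead_coeff (V (Suc r)) \<noteq> 0" using deg by (metis degree_0 leading_coeff_0_iff nat.distinct(1))
  then have "coeff (q - smult k (V (Suc r))) (Suc r) = 0"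
    using deg by (simp add: k_def)
  moreover have "degree (q - smult k (V (Suc r))) \<le> Suc r"
    using deg Suc.prems(3) by (intro degree_diff_le) (auto intro: order.trans[OF degree_smult_le])
  ultimately have "degree (q - smult k (V (Suc r))) \<le> r"
    by (metis degree_0 le_SucE leading_coeff_0_iff zero_le)
  then obtain c where "q - smult k (V (Suc r)) = (\<Sum>h\<le>r. smult (c h) (V h))"
    using Suc.IH[of "q - smult k (V (Suc r))"] Suc.prems by auto
  then have "q = (\<Sum>h\<le>Suc r. smult ((c(Suc r := k)) h) (V h))"
    by (simp add: algebra_simps)
  then show ?case by (rule exI[of _ "c(Suc r := k)"])
qed

lemma poly_basis_independent:
  fixes V :: "nat \<Rightarrow> 'a::field poly"
  assumes "\<And>h. h \<le> r \<Longrightarrow> degree (V h) = h" "V 0 \<noteq> 0"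
    and "(\<Sum>h\<le>r. smult (c h) (V h)) = 0" "h \<le> r"
  shows "c h = 0"
  using assms
proof (induction r)
  case 0
  then show ?case by simp
next
  case (Suc r)
  have deg: "degree (V (Suc r)) = Suc r" using Suc.prems by simp
  have "coeff (\<Sum>h\<le>r. smult (c h) (V h)) (Suc r) = 0"
    using Suc.prems(1) by (auto simp: coeff_sum intro!: sum.neutral coeff_eq_0)
  then have "c (Suc r) * coeff (V (Suc r)) (Suc r) = 0"
    using arg_cong[OF Suc.prems(3), of "\<lambda>q. coeff q (Suc r)"] by simp
  moreover have "coeff (V (Suc r)) (Suc r) \<noteq> 0" using deg
    by (metis degree_0 leading_coeff_0_iff nat.distinct(1))
  ultimately have "c (Suc r) = 0" by simp
  then show ?case using Suc by (cases "h = Suc r") auto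
qed

text \<open>The Lagrange basis polynomial at \<open>a\<close>. It turns the condition that an inner
  product has a given value into a polynomial of controlled degree.\<close>

lemma lagrange_indicator:
  fixes S :: "'a::field set"
  assumes "finite S" "a \<in> S"
  shows "\<exists>q. degree q \<le> card S - 1 \<and> (\<forall>b\<in>S. poly q b = of_bool (b = a))"
proof -
  define q where "q = (\<Prod>b\<in>S - {a}. smult (inverse (a - b)) [:- b, 1:])"
  have "degree q \<le> (\<Sum>b\<in>S - {a}. degree (smult (inverse (a - b)) [:- b, 1:]))"
    unfolding q_def using assms degree_prod_sum_le[of "S - {a}" "\<lambda>b. smult (inverse (a - b)) [:- b, 1:]"]
    by (simp only: o_def finite_Diff)
  also have "\<dots> \<le> (\<Sum>b\<in>S - {a}. 1)"
    by (intro sum_mono) (auto intro: order.trans[OF degree_smult_le])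
  also have "\<dots> = card S - 1"
    using assms by simp
  finally have "degree q \<le> card S - 1" .
  moreover have "poly q b = of_bool (b = a)" if "b \<in> S" for b
  proof (cases "b = a")
    case True
    have "poly q a = (\<Prod>b\<in>S - {a}. inverse (a - b) * (a - b))"
      by (simp add: q_def poly_prod algebra_simps)
    also have "\<dots> = 1"
      by (intro prod.neutral ballI left_inverse) auto
    finally show ?thesis using True by simp
  next
    case False
    then show ?thesis using assms that by (auto simp: q_def poly_prod)
  qed
  ultimately show ?thesis by blast
qed

lemma mscale_sum_apply: "(\<Sum>i\<in>I. mscale (c i) (f i)) x y = (\<Sum>i\<in>I. c i * f i x y)"
  by (induction I rule: infinite_finite_induct) (auto simp: mscale_def)

text \<open>Quantifying over coefficient families indexed by \<open>I\<close>, not over sets of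
  matrices, lets one condition give both injectivity and linear independence.\<close>

lemma mbasisI:
  assumes "finite I"
    and indep: "\<And>c i. (\<And>x y. (\<Sum>i\<in>I. c i * f i x y) = 0) \<Longrightarrow> i \<in> I \<Longrightarrow> c i = 0"
    and "mspan (f ` I) = W"
  shows "mbasis f I W"
proof -
  have inj: "inj_on f I"
  proof (rule inj_onI, rule ccontr)
    fix i j assume ij: "i \<in> I" "j \<in> I" "f i = f j" "i \<noteq> j"
    \<comment> \<open>Two equal matrices would satisfy the relation with coefficients 1 and
      -1.\<close>
    let ?c = "\<lambda>k. of_bool (k = i) - of_bool (k = j) :: real"
    have "(\<Sum>k\<in>I. ?c k * f k x y) = 0" for x y
      using assms(1) ij by (simp add: left_diff_distrib sum_subtractf if_distrib[of "\<lambda>t. t * _"] of_bool_def cong: if_cong)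
    from indep[OF this ij(1)] ij(4) show False by simp
  qed
  have "\<not> mat.dependent (f ` I)"
  proof
    assume "mat.dependent (f ` I)"
    then obtain u v where u: "v \<in> f ` I" "u v \<noteq> 0" "(\<Sum>v\<in>f ` I. mscale (u v) v) = 0"
      using mat.dependent_finite[of "f ` I"] assms(1) by auto
    then have "(\<Sum>i\<in>I. mscale (u (f i)) (f i)) = 0"
      by (simp add: sum.reindex[OF inj])
    then have "(\<Sum>i\<in>I. u (f i) * f i x y) = 0" for x y
      using mscale_sum_apply[of "\<lambda>i. u (f i)" f I x y] by simp
    with indep[of "\<lambda>i. u (f i)"] u show False by auto
  qed
  with inj assms(3) show ?thesis by (simp add: mbasis_def)
qed

section \<open>Coherent configurations from polynomial kernels\<close>

definition inner_products :: "'v::real_inner set \<Rightarrow> 'v set \<Rightarrow> real set" where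
  "inner_products A B = {x \<bullet> y | x y. x \<in> A \<and> y \<in> B}"

text \<open>Parallel to \<open>rtilde\<close>: the largest degree up to which polynomials are
  distinguished by their values on the attained inner products.\<close>

definition inner_degree :: "'v::real_inner set \<Rightarrow> 'v set \<Rightarrow> nat" where
  "inner_degree A B = card (inner_products A B) - 1"

lemma inner_productsI: "x \<in> A \<Longrightarrow> y \<in> B \<Longrightarrow> x \<bullet> y \<in> inner_products A B"
  by (auto simp: inner_products_def)

lemma inner_products_commute: "inner_products A B = inner_products B A"
  unfolding inner_products_def by (intro Collect_cong) (metis inner_commute)

lemma inner_degree_commute: "inner_degree A B = inner_degree B A"
  by (simp only: inner_degree_def inner_products_commute[of A])

lemma inner_products_image: "inner_products A B = (\<lambda>(x, y). x \<bullet> y) ` (A \<times> B)"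
  by (auto simp: inner_products_def)

lemma finite_inner_products: "finite A \<Longrightarrow> finite B \<Longrightarrow> finite (inner_products A B)"
  by (simp add: inner_products_image)

text \<open>The equality case of Cauchy-Schwarz. Within one code, inner product 1 thus singles out
  the diagonal.\<close>

lemma inner_unit_eq_1_iff:
  fixes x y :: "'v::real_inner"
  assumes "norm x = 1" "norm y = 1"
  shows "x \<bullet> y = 1 \<longleftrightarrow> x = y"
proof
  assume "x \<bullet> y = 1"
  then have "(x - y) \<bullet> (x - y) = 0"
    using assms by (simp add: inner_diff inner_commute norm_eq_1)
  then show "x = y" by simp
qed (use assms in \<open>simp add: norm_eq_1\<close>)

text \<open>\<open>convolution\<close> is the matrix unit rule before normalisation.
  \<open>inner_degree_trans\<close> ensures that a nonzero product is again one of the basis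
  matrices. By \<open>V_1\<close> the degree one matrix is a multiple of the inner product, so every
  kernel is a polynomial in it.\<close>

locale inner_product_kernels =
  fixes K :: "'k set" and X :: "'k \<Rightarrow> 'v::real_inner set"
    and V :: "'k \<Rightarrow> 'k \<Rightarrow> nat \<Rightarrow> real poly" and m :: real
  assumes finite_K: "finite K"
    and finite_X: "k \<in> K \<Longrightarrow> finite (X k)"
    and nonempty_X: "k \<in> K \<Longrightarrow> X k \<noteq> {}"
    and norm_X: "k \<in> K \<Longrightarrow> x \<in> X k \<Longrightarrow> norm x = 1"
    and m_nonzero: "m \<noteq> 0"
    and V_0: "V i j 0 = 1"
    and V_1: "V i j (Suc 0) = [:0, m:]"
    and V_commute: "V i j l = V j i l"
    and degree_V: "i \<in> K \<Longrightarrow> j \<in> K \<Longrightarrow> l \<le> inner_degree (X i) (X j) \<Longrightarrow> degree (V i j l) = l"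
    and inner_degree_trans: "i \<in> K \<Longrightarrow> j \<in> K \<Longrightarrow> k \<in> K \<Longrightarrow> l \<le> inner_degree (X i) (X j) \<Longrightarrow>
      l \<le> inner_degree (X j) (X k) \<Longrightarrow> l \<le> inner_degree (X i) (X k)"
    and convolution: "i \<in> K \<Longrightarrow> j \<in> K \<Longrightarrow> k \<in> K \<Longrightarrow> l \<le> inner_degree (X i) (X j) \<Longrightarrow>
      l' \<le> inner_degree (X j) (X k) \<Longrightarrow> x \<in> X i \<Longrightarrow> y \<in> X k \<Longrightarrow>
      (\<Sum>z\<in>X j. poly (V i j l) (x \<bullet> z) * poly (V j k l') (z \<bullet> y)) =
        (if l = l' then card (X j) * poly (V i k l) (x \<bullet> y) else 0)"
begin

abbreviation "Y \<equiv> tagged_union K X"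
abbreviation "\<R> \<equiv> inner_rels K X"
abbreviation "r i j \<equiv> inner_degree (X i) (X j)"

section \<open>Relations and fibers as level sets of the inner product\<close>

definition fib :: "'k \<Rightarrow> ('k \<times> 'v) set" where
  "fib i = {i} \<times> X i"

text \<open>Equal points are not excluded, unlike in \<open>inner_rel\<close>, so the diagonal
  becomes the value 1 and all relations have one form.\<close>

definition lrel :: "'k \<Rightarrow> 'k \<Rightarrow> real \<Rightarrow> ('k \<times> 'v) rel" where
  "lrel i j a = {((i, x), (j, y)) | x y. x \<in> X i \<and> y \<in> X j \<and> x \<bullet> y = a}"

text \<open>Fibers enter as sets, so the tags of the points select the block of \<open>V\<close>.
  The denominator is chosen so that the factor \<open>card (X j)\<close> in
  \<open>convolution\<close> cancels.\<close>

definition E :: "('k \<times> 'v) set \<Rightarrow> ('k \<times> 'v) set \<Rightarrow> nat \<Rightarrow> ('k \<times> 'v) rmat" where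
  "E F G l = (\<lambda>p q. if p \<in> F \<and> q \<in> G
     then poly (V (fst p) (fst q) l) (snd p \<bullet> snd q) / sqrt (real (card F) * real (card G)) else 0)"

lemma lrel_iff: "((k, x), (k', y)) \<in> lrel i j a \<longleftrightarrow> k = i \<and> k' = j \<and> x \<in> X i \<and> y \<in> X j \<and> x \<bullet> y = a"
  by (auto simp: lrel_def)

lemma fib_iff: "(k, x) \<in> fib i \<longleftrightarrow> k = i \<and> x \<in> X i"
  by (auto simp: fib_def)

lemma lrel_diag:
  assumes "i \<in> K" shows "lrel i i 1 = {((i, x), (i, x)) | x. x \<in> X i}"
  using inner_unit_eq_1_iff norm_X[OF assms] by (fastforce simp: lrel_def)

text \<open>One unequal pair decides: with different tags no pair is excluded, and with equal tags
  its inner product is not 1, so no pair with that value is diagonal.\<close>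

lemma lrel_offdiag:
  assumes "i \<in> K" "j \<in> K" "x \<in> X i" "y \<in> X j" "(i, x) \<noteq> (j, y)"
  shows "inner_rel X i j (x \<bullet> y) = lrel i j (x \<bullet> y)"
proof -
  have "(i, u) \<noteq> (j, v)" if "u \<in> X i" "v \<in> X j" "u \<bullet> v = x \<bullet> y" for u v
    using assms that inner_unit_eq_1_iff norm_X by (metis prod.inject)
  then show ?thesis unfolding inner_rel_def lrel_def by blast
qed

lemma one_in_inner_products: "i \<in> K \<Longrightarrow> 1 \<in> inner_products (X i) (X i)"
  using nonempty_X[of i] norm_X[of i] by (force simp: inner_products_def norm_eq_1)

lemma inner_products_E:
  assumes "a \<in> inner_products (X i) (X j)"
  obtains x y where "x \<in> X i" "y \<in> X j" "a = x \<bullet> y"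
  using assms by (auto simp: inner_products_def)

lemma lrel_mem:
  assumes "i \<in> K" "j \<in> K" "a \<in> inner_products (X i) (X j)"
  shows "lrel i j a \<in> \<R>"
proof -
  obtain x y where xy: "x \<in> X i" "y \<in> X j" "a = x \<bullet> y"
    using assms by (elim inner_products_E)
  show ?thesis
  proof (cases "(i, x) = (j, y)")
    case True
    then have "lrel i j a = {((i, x), (i, x)) | x. x \<in> X i}"
      using lrel_diag[OF assms(1)] norm_X[OF assms(1)] xy by (auto simp: norm_eq_1)
    then show ?thesis using assms by (auto simp: inner_rels_def)
  next
    case False
    then have "inner_rel X i j (x \<bullet> y) \<in> \<R>"
      unfolding inner_rels_def using xy assms(1,2) by blast
    then show ?thesis
      using lrel_offdiag[OF assms(1,2) xy(1,2) False] xy(3) by simp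
  qed
qed

lemma inner_rels_E:
  assumes "R \<in> \<R>"
  obtains i j a where "i \<in> K" "j \<in> K" "a \<in> inner_products (X i) (X j)" "R = lrel i j a"
proof -
  consider i where "i \<in> K" "R = {((i, x), (i, x)) | x. x \<in> X i}"
    | i j x y where "i \<in> K" "j \<in> K" "x \<in> X i" "y \<in> X j" "(i, x) \<noteq> (j, y)" "R = inner_rel X i j (x \<bullet> y)"
    using assms unfolding inner_rels_def by blast
  then show ?thesis
  proof cases
    case 1
    then show ?thesis using that[OF _ _ one_in_inner_products] lrel_diag by simp
  next
    case 2
    then show ?thesis using that[OF _ _ inner_productsI] lrel_offdiag by simp
  qed
qed

lemma fib_inj: "i \<in> K \<Longrightarrow> fib i = fib j \<Longrightarrow> i = j"
  using nonempty_X by (auto simp: fib_def)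

text \<open>An attained value comes with an actual pair. If the relation is an identity, this pair
  has equal tags and equal points, which forces the value 1 and hence the whole diagonal of one
  code.\<close>

lemma fibers_eq: "fibers \<R> = fib ` K"
proof (intro equalityI subsetI)
  fix F assume "F \<in> fibers \<R>"
  then obtain i j a where ij: "i \<in> K" "j \<in> K" "a \<in> inner_products (X i) (X j)" "Id_on F = lrel i j a"
    by (auto simp: fibers_def elim: inner_rels_E)
  then obtain x y where xy: "x \<in> X i" "y \<in> X j" "a = x \<bullet> y"
    by (elim inner_products_E)
  then have "((i, x), (j, y)) \<in> Id_on F"
    using ij by (simp add: lrel_iff)
  then have "i = j" "x = y" by auto
  then have "Id_on F = {((i, x), (i, x)) | x. x \<in> X i}"
    using ij xy lrel_diag[of i] norm_X[of i x] by (simp add: norm_eq_1)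
  then have "F = fib i"
    by (auto simp: fib_def Id_on_def set_eq_iff)
  then show "F \<in> fib ` K" using ij by blast
next
  fix F assume "F \<in> fib ` K"
  then obtain i where "i \<in> K" "F = fib i" by blast
  moreover have "Id_on (fib i) = {((i, x), (i, x)) | x. x \<in> X i}"
    by (auto simp: fib_def)
  ultimately show "F \<in> fibers \<R>"
    by (auto simp: fibers_def inner_rels_def)
qed

lemma block_rels_eq:
  assumes "i \<in> K" "j \<in> K"
  shows "block_rels \<R> (fib i) (fib j) = lrel i j ` inner_products (X i) (X j)"
proof (intro equalityI subsetI)
  fix R assume "R \<in> block_rels \<R> (fib i) (fib j)"
  then obtain i' j' a where *: "a \<in> inner_products (X i') (X j')" "R = lrel i' j' a"
      "lrel i' j' a \<subseteq> fib i \<times> fib j"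
    by (auto simp: block_rels_def elim: inner_rels_E)
  then obtain x y where "x \<in> X i'" "y \<in> X j'" "a = x \<bullet> y"
    by (elim inner_products_E)
  then have "((i', x), (j', y)) \<in> lrel i' j' a"
    by (simp add: lrel_iff)
  then have "((i', x), (j', y)) \<in> fib i \<times> fib j" using * by blast
  then show "R \<in> lrel i j ` inner_products (X i) (X j)"
    using * by (auto simp: fib_iff)
next
  fix R assume "R \<in> lrel i j ` inner_products (X i) (X j)"
  then show "R \<in> block_rels \<R> (fib i) (fib j)"
    using lrel_mem[OF assms] by (auto simp: block_rels_def lrel_def fib_iff)
qed

lemma lrel_inj: "inj_on (lrel i j) (inner_products (X i) (X j))"
proof (rule inj_onI)
  fix a b assume "a \<in> inner_products (X i) (X j)" "lrel i j a = lrel i j b"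
  then show "a = b"
    by (metis inner_products_E lrel_iff)
qed

lemma rtilde_eq: "i \<in> K \<Longrightarrow> j \<in> K \<Longrightarrow> rtilde \<R> (fib i) (fib j) = r i j"
  by (simp add: rtilde_def block_rels_eq card_image[OF lrel_inj] inner_degree_def)

section \<open>Expansion in kernels and their independence\<close>

text \<open>Interpolation at the \<open>r i j + 1\<close> values needs degree at most
  \<open>r i j\<close>, which is exactly the range in which \<open>V\<close> is a basis.\<close>

lemma indicator_expand:
  assumes "i \<in> K" "j \<in> K" "a \<in> inner_products (X i) (X j)"
  obtains c where "\<And>x y. x \<in> X i \<Longrightarrow> y \<in> X j \<Longrightarrow>
    of_bool (x \<bullet> y = a) = (\<Sum>l\<le>r i j. c l * poly (V i j l) (x \<bullet> y))"
proof -
  obtain q where q: "degree q \<le> r i j" "\<forall>b\<in>inner_products (X i) (X j). poly q b = of_bool (b = a)"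
    using lagrange_indicator[OF finite_inner_products[OF finite_X finite_X] assms(3)] assms
    by (auto simp: inner_degree_def)
  then obtain c where c: "q = (\<Sum>l\<le>r i j. smult (c l) (V i j l))"
    using poly_basis_expand[of "r i j" "V i j" q] degree_V[OF assms(1,2)] V_0 by auto
  then have "of_bool (x \<bullet> y = a) = (\<Sum>l\<le>r i j. c l * poly (V i j l) (x \<bullet> y))"
    if "x \<in> X i" "y \<in> X j" for x y
    using q(2) inner_productsI[OF that] by (simp add: poly_sum)
  then show ?thesis using that by blast
qed

text \<open>A polynomial of degree at most \<open>r i j\<close> with \<open>r i j + 1\<close> roots
  is zero, so vanishing on the codes already means vanishing as a polynomial.\<close>

lemma kernel_independent:
  assumes "i \<in> K" "j \<in> K"
    and "\<And>x y. x \<in> X i \<Longrightarrow> y \<in> X j \<Longrightarrow> (\<Sum>l\<le>r i j. c l * poly (V i j l) (x \<bullet> y)) = 0"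
    and "l \<le> r i j"
  shows "c l = 0"
proof (rule poly_basis_independent[where V = "V i j" and r = "r i j"])
  let ?q = "\<Sum>l\<le>r i j. smult (c l) (V i j l)"
  have fin: "finite (inner_products (X i) (X j))"
    using assms finite_inner_products finite_X by blast
  have "inner_products (X i) (X j) \<noteq> {}"
    using nonempty_X assms(1,2) by (simp add: inner_products_image)
  then have card: "r i j < card (inner_products (X i) (X j))"
    using fin by (simp add: inner_degree_def card_gt_0_iff)
  have "degree ?q \<le> r i j"
    using degree_V[OF assms(1,2)]
    by (intro degree_sum_le) (auto intro: order.trans[OF degree_smult_le])
  moreover have "poly ?q a = 0" if a: "a \<in> inner_products (X i) (X j)" for a
    using a assms(3) by (auto simp: poly_sum elim!: inner_products_E)
  then have "inner_products (X i) (X j) \<subseteq> {a. poly ?q a = 0}" by blast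
  ultimately show "?q = 0"
    using card card_poly_roots_bound[of ?q] card_mono[OF poly_roots_finite[of ?q]]
    by (metis (no_types, lifting) leD le_trans)
qed (use assms degree_V V_0 in auto)

lemma sum_over_Y:
  assumes "j \<in> K" "\<And>k z. k \<in> K \<Longrightarrow> z \<in> X k \<Longrightarrow> k \<noteq> j \<Longrightarrow> f (k, z) = 0"
  shows "(\<Sum>p\<in>Y. f p) = (\<Sum>z\<in>X j. f (j, z) :: 'b::comm_monoid_add)"
proof -
  have "(\<Sum>p\<in>Y. f p) = (\<Sum>p\<in>fib j. f p)"
    using assms finite_K finite_X
    by (intro sum.mono_neutral_right) (auto simp: tagged_union_def fib_def)
  also have "\<dots> = (\<Sum>z\<in>X j. f (j, z))"
    by (intro sum.reindex_bij_witness[of _ "Pair j" snd]) (auto simp: fib_def)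
  finally show ?thesis .
qed

section \<open>Intersection numbers and the axioms of a coherent configuration\<close>

lemma finite_Y: "finite Y"
  using finite_K finite_X by (auto simp: tagged_union_def)

text \<open>Both relations are expanded in kernels; \<open>convolution\<close> then sums out the
  middle point and leaves kernels at \<open>x \<bullet> y\<close> only.\<close>

lemma intersection_number:
  assumes ij: "i \<in> K" "j \<in> K" "a \<in> inner_products (X i) (X j)"
    and jk: "k \<in> K" "b \<in> inner_products (X j) (X k)"
  obtains f where "\<And>x y. x \<in> X i \<Longrightarrow> y \<in> X k \<Longrightarrow>
    card {z. ((i, x), z) \<in> lrel i j a \<and> (z, (k, y)) \<in> lrel j k b} = f (x \<bullet> y)"
proof -
  obtain c where c: "\<And>x y. x \<in> X i \<Longrightarrow> y \<in> X j \<Longrightarrow>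
      of_bool (x \<bullet> y = a) = (\<Sum>l\<le>r i j. c l * poly (V i j l) (x \<bullet> y))"
    using indicator_expand[OF ij] by blast
  obtain c' where c': "\<And>x y. x \<in> X j \<Longrightarrow> y \<in> X k \<Longrightarrow>
      of_bool (x \<bullet> y = b) = (\<Sum>l\<le>r j k. c' l * poly (V j k l) (x \<bullet> y))"
    using indicator_expand[OF ij(2) jk] by blast
  define g where "g t = (\<Sum>l\<le>r i j. \<Sum>l'\<le>r j k. c l * c' l' *
      (if l = l' then real (card (X j)) * poly (V i k l) t else 0))" for t
  have key: "real (card {z. ((i, x), z) \<in> lrel i j a \<and> (z, (k, y)) \<in> lrel j k b}) = g (x \<bullet> y)"
    if xy: "x \<in> X i" "y \<in> X k" for x y
  proof -
    have "{z. ((i, x), z) \<in> lrel i j a \<and> (z, (k, y)) \<in> lrel j k b} =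
        Pair j ` {z \<in> X j. x \<bullet> z = a \<and> z \<bullet> y = b}"
      using xy by (auto simp: lrel_iff)
    then have "real (card {z. ((i, x), z) \<in> lrel i j a \<and> (z, (k, y)) \<in> lrel j k b}) =
        real (card {z \<in> X j. x \<bullet> z = a \<and> z \<bullet> y = b})"
      by (simp add: card_image inj_on_def)
    also have "\<dots> = (\<Sum>z\<in>X j. of_bool (x \<bullet> z = a) * of_bool (z \<bullet> y = b))"
      using finite_X[OF ij(2)] by (simp add: flip: of_bool_conj sum.inter_filter) (simp add: Int_def)
    also have "\<dots> = (\<Sum>z\<in>X j. (\<Sum>l\<le>r i j. c l * poly (V i j l) (x \<bullet> z)) *
        (\<Sum>l'\<le>r j k. c' l' * poly (V j k l') (z \<bullet> y)))"
      by (intro sum.cong refl) (simp only: c[OF xy(1)] c'[OF _ xy(2)])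
    also have "\<dots> = (\<Sum>z\<in>X j. \<Sum>l\<le>r i j. \<Sum>l'\<le>r j k.
        c l * c' l' * (poly (V i j l) (x \<bullet> z) * poly (V j k l') (z \<bullet> y)))"
      by (intro sum.cong refl, subst sum_product, intro sum.cong refl) simp
    also have "\<dots> = (\<Sum>l\<le>r i j. \<Sum>l'\<le>r j k. \<Sum>z\<in>X j.
        c l * c' l' * (poly (V i j l) (x \<bullet> z) * poly (V j k l') (z \<bullet> y)))"
      by (subst sum.swap, intro sum.cong refl, subst sum.swap, rule refl)
    also have "\<dots> = g (x \<bullet> y)"
      unfolding g_def
    proof (intro sum.cong refl)
      fix l l' assume "l \<in> {..r i j}" "l' \<in> {..r j k}"
      then show "(\<Sum>z\<in>X j. c l * c' l' * (poly (V i j l) (x \<bullet> z) * poly (V j k l') (z \<bullet> y))) =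
          c l * c' l' * (if l = l' then real (card (X j)) * poly (V i k l) (x \<bullet> y) else 0)"
        using convolution[OF ij(1,2) jk(1) _ _ xy] by (simp flip: sum_distrib_left)
    qed
    finally show ?thesis .
  qed
  show ?thesis
  \<comment> \<open>\<open>g\<close> is real-valued, but a natural number at attained inner
    products, where the floor recovers it.\<close>
  proof (rule that[of "\<lambda>t. nat \<lfloor>g t\<rfloor>"])
    fix x y assume "x \<in> X i" "y \<in> X k"
    from key[OF this, symmetric]
    show "card {z. ((i, x), z) \<in> lrel i j a \<and> (z, (k, y)) \<in> lrel j k b} = nat \<lfloor>g (x \<bullet> y)\<rfloor>"
      by (simp only: floor_of_nat nat_int)
  qed
qed

lemma lrel_disjoint: "p \<in> lrel i j a \<Longrightarrow> p \<in> lrel i' j' a' \<Longrightarrow> lrel i j a = lrel i' j' a'"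
  by (auto simp: lrel_def)

lemma lrel_converse: "(lrel i j a)\<inverse> = lrel j i a"
  by (auto simp: lrel_def inner_commute)

lemma coherent: "coherent_configuration Y \<R>"
  unfolding coherent_configuration_def
proof (intro conjI ballI impI)
  show "finite Y" by (rule finite_Y)
  show "\<Union>\<R> = Y \<times> Y"
  proof (intro equalityI subsetI)
    fix pq assume "pq \<in> \<Union>\<R>"
    then obtain i j a where "i \<in> K" "j \<in> K" "pq \<in> lrel i j a"
      by (blast elim: inner_rels_E)
    then show "pq \<in> Y \<times> Y"
      by (auto simp: lrel_def tagged_union_def)
  next
    fix pq assume "pq \<in> Y \<times> Y"
    then obtain i x j y where *: "pq = ((i, x), (j, y))" "i \<in> K" "j \<in> K" "x \<in> X i" "y \<in> X j"
      by (auto simp: tagged_union_def)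
    then have "pq \<in> lrel i j (x \<bullet> y)"
      by (simp add: lrel_iff)
    then show "pq \<in> \<Union>\<R>"
      using lrel_mem[OF *(2,3) inner_productsI[OF *(4,5)]] by blast
  qed
  show "pairwise disjnt \<R>"
    unfolding pairwise_def disjnt_def
    by (auto elim!: inner_rels_E dest: lrel_disjoint)
  show "{} \<notin> \<R>"
  proof
    assume "{} \<in> \<R>"
    then obtain i j a where "a \<in> inner_products (X i) (X j)" "lrel i j a = {}"
      by (metis inner_rels_E)
    then show False
      by (metis inner_products_E lrel_iff empty_iff)
  qed
  show "R\<inverse> \<in> \<R>" if "R \<in> \<R>" for R
    using that by (auto elim!: inner_rels_E simp: lrel_converse inner_products_commute intro!: lrel_mem)
  show "R \<subseteq> Id_on Y" if R: "R \<in> \<R>" "R \<inter> Id_on Y \<noteq> {}" for R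
  proof -
    obtain i j a where *: "i \<in> K" "R = lrel i j a"
      using R by (elim inner_rels_E)
    then obtain p where "p \<in> Y" "(p, p) \<in> lrel i j a"
      using R by auto
    then have "j = i" "a = 1"
      using norm_X[OF *(1)] by (auto simp: lrel_def norm_eq_1)
    then show ?thesis
      using * lrel_diag[OF *(1)] by (auto simp: tagged_union_def)
  qed
  fix R R' R'' assume R: "R \<in> \<R>" and R': "R' \<in> \<R>" and R'': "R'' \<in> \<R>"
  obtain i j a where ij: "i \<in> K" "j \<in> K" "a \<in> inner_products (X i) (X j)" "R = lrel i j a"
    using R by (elim inner_rels_E)
  obtain j' k b where jk: "j' \<in> K" "k \<in> K" "b \<in> inner_products (X j') (X k)" "R' = lrel j' k b"
    using R' by (elim inner_rels_E)
  obtain i' k' e where ik: "i' \<in> K" "k' \<in> K" "R'' = lrel i' k' e"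
    using R'' by (elim inner_rels_E)
  show "\<exists>n. \<forall>(p, q)\<in>R''. card {z. (p, z) \<in> R \<and> (z, q) \<in> R'} = n"
  \<comment> \<open>Unless all tags fit together, no intermediate point exists and the constant is
    0.\<close>
  proof (cases "j = j' \<and> i = i' \<and> k = k'")
    case True
    then have b: "b \<in> inner_products (X j) (X k)" using jk(3) by simp
    obtain f where "\<And>x y. x \<in> X i \<Longrightarrow> y \<in> X k \<Longrightarrow>
        card {z. ((i, x), z) \<in> lrel i j a \<and> (z, (k, y)) \<in> lrel j k b} = f (x \<bullet> y)"
      using intersection_number[OF ij(1-3) jk(2) b] by blast
    then have "\<forall>(p, q)\<in>R''. card {z. (p, z) \<in> R \<and> (z, q) \<in> R'} = f e"
      using True ij jk ik by (auto simp: lrel_iff)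
    then show ?thesis by blast
  next
    case False
    have empty: "{z. (p, z) \<in> R \<and> (z, q) \<in> R'} = {}" if "(p, q) \<in> R''" for p q
      using False that unfolding ij(4) jk(4) ik(3) by (auto simp: lrel_def)
    show ?thesis
    proof (intro exI[of _ 0] ballI)
      fix pq assume "pq \<in> R''"
      then show "case pq of (p, q) \<Rightarrow> card {z. (p, z) \<in> R \<and> (z, q) \<in> R'} = 0"
        by (cases pq) (simp only: prod.case empty card.empty)
    qed
  qed
qed

text \<open>The axioms are inherited from the whole configuration; symmetry holds because the
  converse only swaps the two tags, which agree here.\<close>

lemma association_scheme:
  assumes i: "i \<in> K"
  shows "symmetric_association_scheme (fib i) (block_rels \<R> (fib i) (fib i))"
proof -
  let ?B = "block_rels \<R> (fib i) (fib i)"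
  note B = block_rels_eq[OF i i]
  have coh: "pairwise disjnt \<R>" "{} \<notin> \<R>"
      "\<forall>R\<in>\<R>. R \<inter> Id_on Y \<noteq> {} \<longrightarrow> R \<subseteq> Id_on Y"
      "\<forall>R\<in>\<R>. \<forall>R'\<in>\<R>. \<forall>R''\<in>\<R>. \<exists>n. \<forall>(x, y)\<in>R''. card {z. (x, z) \<in> R \<and> (z, y) \<in> R'} = n"
    using coherent unfolding coherent_configuration_def by - (elim conjE, assumption)+
  have sub: "?B \<subseteq> \<R>" by (auto simp: block_rels_def)
  have fibY: "fib i \<subseteq> Y" using i by (auto simp: fib_def tagged_union_def)
  have sym: "R\<inverse> = R" if "R \<in> ?B" for R
    using that unfolding B by (metis imageE lrel_converse)
  have "coherent_configuration (fib i) ?B"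
    unfolding coherent_configuration_def
  proof (intro conjI ballI impI)
    show "finite (fib i)" using finite_X[OF i] by (simp add: fib_def)
    show "\<Union>?B = fib i \<times> fib i"
    proof (intro equalityI subsetI)
      fix pq assume pq: "pq \<in> fib i \<times> fib i"
      then obtain x y where "pq = ((i, x), (i, y))" "x \<in> X i" "y \<in> X i"
        by (auto simp: fib_def)
      then show "pq \<in> \<Union>?B"
        by (auto simp: B lrel_iff inner_products_def)
    qed (auto simp: block_rels_def)
    show "pairwise disjnt ?B" using coh(1) sub by (rule pairwise_subset)
    show "{} \<notin> ?B" using coh(2) sub by blast
    show "R\<inverse> \<in> ?B" if "R \<in> ?B" for R using sym that by simp
    show "R \<subseteq> Id_on (fib i)" if "R \<in> ?B" "R \<inter> Id_on (fib i) \<noteq> {}" for R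
    proof -
      have "R \<inter> Id_on Y \<noteq> {}" using that fibY by blast
      then have "R \<subseteq> Id_on Y" using coh(3) sub that by blast
      then show ?thesis using that by (auto simp: block_rels_def)
    qed
    show "\<exists>n. \<forall>(x, y)\<in>R''. card {z. (x, z) \<in> R \<and> (z, y) \<in> R'} = n"
      if "R \<in> ?B" "R' \<in> ?B" "R'' \<in> ?B" for R R' R''
      using coh(4)[rule_format, OF subsetD[OF sub] subsetD[OF sub] subsetD[OF sub], OF that] .
  qed
  moreover have "Id_on (fib i) \<in> ?B"
    using i fibers_eq by (auto simp: block_rels_def fibers_def)
  moreover have "sym R" if "R \<in> ?B" for R
    using sym[OF that] by (simp add: sym_conv_converse_eq)
  ultimately show ?thesis by (auto simp: symmetric_association_scheme_def)
qed

section \<open>Normalised kernels as a basis of the matrix spans\<close>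

definition scale :: "'k \<Rightarrow> 'k \<Rightarrow> real" where
  "scale i j = sqrt (real (card (X i)) * real (card (X j)))"

lemma card_pos: "i \<in> K \<Longrightarrow> card (X i) > 0"
  using finite_X nonempty_X by (simp add: card_gt_0_iff)

lemma scale_pos: "i \<in> K \<Longrightarrow> j \<in> K \<Longrightarrow> scale i j > 0"
  using card_pos by (simp add: scale_def)

lemma scale_mult: "scale i j * scale j k = real (card (X j)) * scale i k"
  by (simp add: scale_def real_sqrt_mult)

lemma card_fib: "card (fib i) = card (X i)"
  by (simp add: fib_def card_cartesian_product)

lemma E_apply:
  "E (fib i) (fib j) l (a, x) (b, y) =
    (if a = i \<and> b = j \<and> x \<in> X i \<and> y \<in> X j then poly (V i j l) (x \<bullet> y) / scale i j else 0)"
  by (auto simp: E_def card_fib scale_def fib_iff)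

lemma adj_lrel_apply:
  "adj (lrel i j t) (a, x) (b, y) = of_bool (a = i \<and> b = j \<and> x \<in> X i \<and> y \<in> X j \<and> x \<bullet> y = t)"
  by (simp add: adj_def lrel_iff)

text \<open>The kernel is constant on each relation of the block, so its values are the coefficients
  of the adjacency matrices.\<close>

lemma E_in_span:
  assumes "i \<in> K" "j \<in> K"
  shows "E (fib i) (fib j) l \<in> mat.span (adj ` block_rels \<R> (fib i) (fib j))"
proof -
  let ?A = "inner_products (X i) (X j)"
  have fin: "finite ?A" using assms finite_inner_products finite_X by blast
  have "E (fib i) (fib j) l = (\<Sum>t\<in>?A. mscale (poly (V i j l) t / scale i j) (adj (lrel i j t)))"
  proof (intro ext)
    fix p q :: "'k \<times> 'v"
    obtain a x b y where pq: "p = (a, x)" "q = (b, y)" by fastforce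
    show "E (fib i) (fib j) l p q =
        (\<Sum>t\<in>?A. mscale (poly (V i j l) t / scale i j) (adj (lrel i j t))) p q"
    proof (cases "a = i \<and> b = j \<and> x \<in> X i \<and> y \<in> X j")
      case True
      then have "x \<bullet> y \<in> ?A" using inner_productsI by blast
      then show ?thesis using True fin
        by (simp add: pq E_apply mscale_sum_apply adj_lrel_apply of_bool_def if_distrib[of "\<lambda>t. _ * t"] cong: if_cong)
    next
      case False
      then show ?thesis
        by (auto simp: pq E_apply mscale_sum_apply adj_lrel_apply intro!: sum.neutral[symmetric])
    qed
  qed
  also have "\<dots> \<in> mat.span (adj ` block_rels \<R> (fib i) (fib j))"
    by (intro mat.span_sum mat.span_scale mat.span_base) (auto simp: block_rels_eq[OF assms])
  finally show ?thesis .
qed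

lemma adj_in_span:
  assumes "i \<in> K" "j \<in> K" "t \<in> inner_products (X i) (X j)"
  shows "adj (lrel i j t) \<in> mat.span (E (fib i) (fib j) ` {..r i j})"
proof -
  obtain c where c: "\<And>x y. x \<in> X i \<Longrightarrow> y \<in> X j \<Longrightarrow>
      of_bool (x \<bullet> y = t) = (\<Sum>l\<le>r i j. c l * poly (V i j l) (x \<bullet> y))"
    using indicator_expand[OF assms] by blast
  \<comment> \<open>The factor \<open>scale i j\<close> undoes the normalisation of
    \<open>E\<close>.\<close>
  have "adj (lrel i j t) = (\<Sum>l\<le>r i j. mscale (c l * scale i j) (E (fib i) (fib j) l))"
  proof (intro ext)
    fix p q :: "'k \<times> 'v"
    obtain a x b y where pq: "p = (a, x)" "q = (b, y)" by fastforce
    show "adj (lrel i j t) p q = (\<Sum>l\<le>r i j. mscale (c l * scale i j) (E (fib i) (fib j) l)) p q"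
    proof (cases "a = i \<and> b = j \<and> x \<in> X i \<and> y \<in> X j")
      case True
      then show ?thesis using c[of x y] scale_pos[OF assms(1,2)]
        by (simp add: pq E_apply mscale_sum_apply adj_lrel_apply)
    next
      case False
      then show ?thesis
        by (auto simp: pq E_apply mscale_sum_apply adj_lrel_apply intro!: sum.neutral[symmetric])
    qed
  qed
  also have "\<dots> \<in> mat.span (E (fib i) (fib j) ` {..r i j})"
    by (intro mat.span_sum mat.span_scale mat.span_base) auto
  finally show ?thesis .
qed

lemma mbasis_block:
  assumes "i \<in> K" "j \<in> K"
  shows "mbasis (E (fib i) (fib j)) {..r i j} (mspan (adj ` block_rels \<R> (fib i) (fib j)))"
proof (rule mbasisI)
  fix c l assume c: "\<And>p q. (\<Sum>l\<le>r i j. c l * E (fib i) (fib j) l p q) = 0" and l: "l \<in> {..r i j}"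
  have "(\<Sum>l\<le>r i j. c l * poly (V i j l) (x \<bullet> y)) = 0" if "x \<in> X i" "y \<in> X j" for x y
    using c[of "(i, x)" "(j, y)"] that scale_pos[OF assms]
    by (simp add: E_apply flip: sum_divide_distrib)
  then show "c l = 0" using kernel_independent[OF assms] l by blast
next
  show "mspan (E (fib i) (fib j) ` {..r i j}) = mspan (adj ` block_rels \<R> (fib i) (fib j))"
    unfolding mspan_def mat.span_eq
    using E_in_span[OF assms] adj_in_span[OF assms] by (auto simp: block_rels_eq[OF assms])
qed simp

text \<open>Matrices of different blocks have disjoint supports, so a linear relation among all of
  them can be tested block by block.\<close>

lemma mbasis_all:
  "mbasis (\<lambda>(F, G, l). E F G l)
     {(F, G, l). F \<in> fibers \<R> \<and> G \<in> fibers \<R> \<and> l \<le> rtilde \<R> F G} (mspan (adj ` \<R>))"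
proof (rule mbasisI)
  let ?I = "{(F, G, l). F \<in> fibers \<R> \<and> G \<in> fibers \<R> \<and> l \<le> rtilde \<R> F G}"
  let ?e = "\<lambda>(F, G, l). E F G l"
  have "?I = Sigma (fibers \<R>) (\<lambda>F. Sigma (fibers \<R>) (\<lambda>G. {..rtilde \<R> F G}))"
    by auto
  moreover have "finite (fibers \<R>)"
    using finite_K by (simp add: fibers_eq)
  ultimately show fin: "finite ?I"
    by simp
  fix c t assume c: "\<And>p q. (\<Sum>t\<in>?I. c t * ?e t p q) = 0" and "t \<in> ?I"
  then obtain i j l where t: "i \<in> K" "j \<in> K" "l \<le> r i j" "t = (fib i, fib j, l)"
    by (auto simp: fibers_eq rtilde_eq)
  have "(\<Sum>l\<le>r i j. c (fib i, fib j, l) * poly (V i j l) (x \<bullet> y)) = 0"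
    if xy: "x \<in> X i" "y \<in> X j" for x y
  proof -
    \<comment> \<open>The indices of the block containing this entry; all other summands vanish
      there.\<close>
    let ?J = "(\<lambda>l. (fib i, fib j, l)) ` {..r i j}"
    have "0 = (\<Sum>t\<in>?I. c t * ?e t (i, x) (j, y))"
      using c by simp
    also have "\<dots> = (\<Sum>t\<in>?J. c t * ?e t (i, x) (j, y))"
    proof (rule sum.mono_neutral_right[OF fin])
      show "?J \<subseteq> ?I" using t by (auto simp: fibers_eq rtilde_eq)
      show "\<forall>t\<in>?I - ?J. c t * ?e t (i, x) (j, y) = 0"
      proof
        fix t assume "t \<in> ?I - ?J"
        then obtain F G l' where FG: "F \<in> fibers \<R>" "G \<in> fibers \<R>" "l' \<le> rtilde \<R> F G"
            "t = (F, G, l')" "t \<notin> ?J"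
          by auto
        then obtain i' j' where ij': "i' \<in> K" "j' \<in> K" "F = fib i'" "G = fib j'"
          by (auto simp: fibers_eq)
        then have "\<not> (i' = i \<and> j' = j)"
          using FG by (auto simp: rtilde_eq)
        then show "c t * ?e t (i, x) (j, y) = 0"
          using FG ij' by (auto simp: E_apply)
      qed
    qed
    also have "\<dots> = (\<Sum>l\<le>r i j. c (fib i, fib j, l) * E (fib i) (fib j) l (i, x) (j, y))"
      by (subst sum.reindex) (auto simp: inj_on_def)
    also have "\<dots> = (\<Sum>l\<le>r i j. c (fib i, fib j, l) * poly (V i j l) (x \<bullet> y)) / scale i j"
      using xy by (simp add: E_apply sum_divide_distrib)
    finally show ?thesis using scale_pos[OF t(1,2)] by simp
  qed
  from kernel_independent[OF t(1,2) this t(3)] show "c t = 0"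
    using t(4) by simp
next
  let ?S = "(\<lambda>(F, G, l). E F G l) ` {(F, G, l). F \<in> fibers \<R> \<and> G \<in> fibers \<R> \<and> l \<le> rtilde \<R> F G}"
  have "E (fib i) (fib j) l \<in> mat.span (adj ` \<R>)" if "i \<in> K" "j \<in> K" for i j l
    using E_in_span[OF that] mat.span_mono[of "adj ` block_rels \<R> (fib i) (fib j)" "adj ` \<R>"]
    by (auto simp: block_rels_def)
  then have "?S \<subseteq> mat.span (adj ` \<R>)"
    by (auto simp: fibers_eq)
  moreover have "adj R \<in> mat.span ?S" if "R \<in> \<R>" for R
  proof -
    obtain i j a where *: "i \<in> K" "j \<in> K" "a \<in> inner_products (X i) (X j)" "R = lrel i j a"
      using \<open>R \<in> \<R>\<close> by (elim inner_rels_E)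
    have "E (fib i) (fib j) ` {..r i j} \<subseteq> ?S"
      using * by (force simp: fibers_eq rtilde_eq image_iff)
    then show ?thesis
      using adj_in_span[OF *(1-3)] mat.span_mono *(4) by blast
  qed
  ultimately show "mspan ?S = mspan (adj ` \<R>)"
    unfolding mspan_def mat.span_eq by blast
qed

section \<open>Product rule and the Q-polynomial property\<close>

lemma E_transpose: "mtranspose (E F G l) = E G F l"
proof (intro ext)
  fix p q :: "'k \<times> 'v"
  show "mtranspose (E F G l) p q = E G F l p q"
    using V_commute[of "fst q" "fst p" l] inner_commute[of "snd q" "snd p"]
    by (simp add: mtranspose_def E_def mult.commute conj_commute)
qed

lemma E_0: "E F G 0 = mscale (1 / sqrt (real (card F) * real (card G))) (adj (F \<times> G))"
  by (simp add: E_def V_0 mscale_def adj_def fun_eq_iff)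

text \<open>Only points of the middle fiber contribute; \<open>scale_mult\<close> absorbs the factor
  \<open>card (X j)\<close> into the normalisation of the outer block.\<close>

lemma E_mult:
  assumes K: "i \<in> K" "j \<in> K" "k \<in> K" and l: "l \<le> r i j" "l' \<le> r j k"
  shows "mmult Y (E (fib i) (fib j) l) (E (fib j) (fib k) l') = (if l = l' then E (fib i) (fib k) l else 0)"
proof (intro ext)
  fix p q :: "'k \<times> 'v"
  obtain a x b y where pq: "p = (a, x)" "q = (b, y)" by fastforce
  have "mmult Y (E (fib i) (fib j) l) (E (fib j) (fib k) l') p q =
      (\<Sum>z\<in>X j. E (fib i) (fib j) l (a, x) (j, z) * E (fib j) (fib k) l' (j, z) (b, y))"
    unfolding mmult_def pq by (rule sum_over_Y[OF K(2)]) (simp add: E_apply)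
  also have "\<dots> = (if l = l' then E (fib i) (fib k) l else 0) (a, x) (b, y)"
  proof (cases "a = i \<and> b = k \<and> x \<in> X i \<and> y \<in> X k")
    case True
    then have "(\<Sum>z\<in>X j. E (fib i) (fib j) l (a, x) (j, z) * E (fib j) (fib k) l' (j, z) (b, y)) =
        (\<Sum>z\<in>X j. poly (V i j l) (x \<bullet> z) * poly (V j k l') (z \<bullet> y)) / (scale i j * scale j k)"
      by (simp add: E_apply sum_divide_distrib)
    also have "\<dots> = (if l = l' then poly (V i k l) (x \<bullet> y) / scale i k else 0)"
      using True convolution[OF K l, of x y] card_pos[OF K(2)] by (simp add: scale_mult)
    finally show ?thesis using True by (simp add: E_apply)
  next
    case False
    then show ?thesis by (auto simp: E_apply intro!: sum.neutral)
  qed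
  finally show "mmult Y (E (fib i) (fib j) l) (E (fib j) (fib k) l') p q =
      (if l = l' then E (fib i) (fib k) l else 0) p q" by (simp add: pq)
qed

lemma E_mult_0:
  assumes "j \<noteq> j'"
  shows "mmult Y (E (fib i) (fib j) l) (E (fib j') (fib k) l') = 0"
proof (intro ext)
  fix p q :: "'k \<times> 'v"
  have *: "E (fib i) (fib j) l p z * E (fib j') (fib k) l' z q = 0" for z
    using assms by (auto simp: E_def fib_def)
  then show "mmult Y (E (fib i) (fib j) l) (E (fib j') (fib k) l') p q = 0 p q"
    by (simp only: mmult_def * sum.neutral_const zero_fun_apply)
qed

lemma idempotent_type_basis_E: "idempotent_type_basis Y \<R> E"
  unfolding idempotent_type_basis_def
proof (intro conjI)
  show "mbasis (\<lambda>(F, G, l). E F G l)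
     {(F, G, l). F \<in> fibers \<R> \<and> G \<in> fibers \<R> \<and> l \<le> rtilde \<R> F G} (mspan (adj ` \<R>))"
    by (rule mbasis_all)
  show "\<forall>F\<in>fibers \<R>. \<forall>G\<in>fibers \<R>. mbasis (E F G) {..rtilde \<R> F G} (mspan (adj ` block_rels \<R> F G))"
    using mbasis_block by (simp add: fibers_eq rtilde_eq)
  show "\<forall>F\<in>fibers \<R>. \<forall>G\<in>fibers \<R>. \<forall>F'\<in>fibers \<R>. \<forall>G'\<in>fibers \<R>.
        \<forall>l\<le>rtilde \<R> F G. \<forall>l'\<le>rtilde \<R> F' G'.
          if l = l' \<and> G = F'
          then l \<le> rtilde \<R> F G' \<and> mmult Y (E F G l) (E F' G' l') = E F G' l
          else mmult Y (E F G l) (E F' G' l') = 0"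
    unfolding fibers_eq
  proof (intro ballI allI impI; elim imageE)
    fix F G F' G' l l' i j j' k
    assume *: "l \<le> rtilde \<R> F G" "l' \<le> rtilde \<R> F' G'" "F = fib i" "G = fib j" "F' = fib j'" "G' = fib k"
      "i \<in> K" "j \<in> K" "j' \<in> K" "k \<in> K"
    then have l: "l \<le> r i j" "l' \<le> r j' k" by (simp_all add: rtilde_eq)
    show "if l = l' \<and> G = F' then l \<le> rtilde \<R> F G' \<and> mmult Y (E F G l) (E F' G' l') = E F G' l
          else mmult Y (E F G l) (E F' G' l') = 0"
    proof (cases "j = j'")
      case True
      \<comment> \<open>\<open>inner_degree_trans\<close> supplies the extra claim that
        \<open>l\<close> is an index of the outer block.\<close>
      then show ?thesis
        using * l E_mult[of i j k l l'] inner_degree_trans[of i j k l] by (auto simp: rtilde_eq)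
    next
      case False
      then have "G \<noteq> F'" using * fib_inj by blast
      then show ?thesis using * E_mult_0[OF False] by simp
    qed
  qed
qed (auto simp: E_0 E_transpose)

theorem Q_polynomial: "Q_polynomial_coherent_configuration Y \<R>"
  unfolding Q_polynomial_coherent_configuration_def
proof (intro conjI exI[of _ E])
  show "coherent_configuration Y \<R>" by (rule coherent)
  show "\<forall>F\<in>fibers \<R>. symmetric_association_scheme F (block_rels \<R> F F)"
    using association_scheme by (simp add: fibers_eq)
  show "idempotent_type_basis Y \<R> E" by (rule idempotent_type_basis_E)
  show "\<forall>F\<in>fibers \<R>. \<forall>G\<in>fibers \<R>. \<exists>v :: nat \<Rightarrow> real poly. \<forall>h\<le>rtilde \<R> F G.
           degree (v h) = h \<and>
           mscale (sqrt (real (card F) * real (card G))) (E F G h) =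
             entrywise_poly F G (v h) (mscale (sqrt (real (card F) * real (card G))) (E F G 1))"
    unfolding fibers_eq
  proof (intro ballI; elim imageE)
    fix F G i j assume *: "F = fib i" "G = fib j" "i \<in> K" "j \<in> K"
    have s: "scale i j > 0" using scale_pos * by simp
    show "\<exists>v :: nat \<Rightarrow> real poly. \<forall>h\<le>rtilde \<R> F G.
           degree (v h) = h \<and>
           mscale (sqrt (real (card F) * real (card G))) (E F G h) =
             entrywise_poly F G (v h) (mscale (sqrt (real (card F) * real (card G))) (E F G 1))"
    \<comment> \<open>The rescaled degree one matrix has entries \<open>m * (x \<bullet> y)\<close>,
      so the argument is divided by \<open>m\<close> first; this keeps the degree.\<close>
    proof (intro exI[of _ "\<lambda>h. pcompose (V i j h) [:0, 1 / m:]"] allI impI conjI ext)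
      fix h assume "h \<le> rtilde \<R> F G"
      then show "degree (pcompose (V i j h) [:0, 1 / m:]) = h"
        using * degree_V m_nonzero by (simp add: rtilde_eq degree_pcompose)
      fix p q :: "'k \<times> 'v"
      obtain a x b y where pq: "p = (a, x)" "q = (b, y)" by fastforce
      show "mscale (sqrt (real (card F) * real (card G))) (E F G h) p q =
          entrywise_poly F G (pcompose (V i j h) [:0, 1 / m:])
            (mscale (sqrt (real (card F) * real (card G))) (E F G 1)) p q"
        unfolding * card_fib scale_def[symmetric] pq
        using s m_nonzero by (auto simp: entrywise_poly_def mscale_def E_apply fib_iff V_1 poly_pcompose)
    qed
  qed
qed

end

section \<open>Bounds on the number of inner products\<close>

lemma inner_degree_ge_1:
  assumes "finite A" "finite B" "s \<in> inner_products A B" "t \<in> inner_products A B" "s \<noteq> t"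
  shows "1 \<le> inner_degree A B"
proof -
  have "card {s, t} \<le> card (inner_products A B)"
    using assms by (intro card_mono finite_inner_products) auto
  then show ?thesis using assms(5) by (simp add: inner_degree_def)
qed

lemma inner_degree_le:
  assumes "finite S" "inner_products A B \<subseteq> S" "card S \<le> Suc n"
  shows "inner_degree A B \<le> n"
  using card_mono[OF assms(1,2)] assms(3) by (simp add: inner_degree_def)

section \<open>Unions of simplices together with a cross polytope\<close>

text \<open>Here \<open>P\<close> plays the role of the complement of \<open>p\<close>, \<open>m = d - 1\<close> is its dimension, \<open>G j\<close> is the
  simplex obtained from the basis with index \<open>j\<close>, and \<open>B\<close> is the cross polytope.\<close>

locale derived_mub_frame =
  fixes P :: "'v::real_inner set" and J :: "'j set" and G :: "'j \<Rightarrow> 'v set" and B :: "'v set"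
    and m :: real
  assumes m_pos: "m > 0"
    and finite_J: "finite J"
    and card_J: "2 * real (card J) = m + 1"
    and uminus_P: "x \<in> P \<Longrightarrow> - x \<in> P"
    and finite_G: "j \<in> J \<Longrightarrow> finite (G j)"
    and card_G: "j \<in> J \<Longrightarrow> real (card (G j)) = m + 1"
    and G_P: "j \<in> J \<Longrightarrow> x \<in> G j \<Longrightarrow> x \<in> P"
    and norm_G: "j \<in> J \<Longrightarrow> x \<in> G j \<Longrightarrow> norm x = 1"
    and sum_G: "j \<in> J \<Longrightarrow> x \<in> P \<Longrightarrow> (\<Sum>z\<in>G j. x \<bullet> z) = 0"
    and frame_G: "j \<in> J \<Longrightarrow> x \<in> P \<Longrightarrow> y \<in> P \<Longrightarrow> (\<Sum>z\<in>G j. (x \<bullet> z) * (z \<bullet> y)) = (m + 1) / m * (x \<bullet> y)"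
    and inner_G_same: "j \<in> J \<Longrightarrow> x \<in> G j \<Longrightarrow> y \<in> G j \<Longrightarrow> x \<noteq> y \<Longrightarrow> m * (x \<bullet> y) = - 1"
    and inner_G_diff: "i \<in> J \<Longrightarrow> j \<in> J \<Longrightarrow> i \<noteq> j \<Longrightarrow> x \<in> G i \<Longrightarrow> y \<in> G j \<Longrightarrow> (m * (x \<bullet> y) + 1)\<^sup>2 = m + 1"
    and finite_B: "finite B"
    and card_B: "real (card B) = 2 * m"
    and B_P: "x \<in> B \<Longrightarrow> x \<in> P"
    and norm_B: "x \<in> B \<Longrightarrow> norm x = 1"
    and uminus_B: "x \<in> B \<Longrightarrow> - x \<in> B"
    and frame_B: "x \<in> P \<Longrightarrow> y \<in> P \<Longrightarrow> (\<Sum>z\<in>B. (x \<bullet> z) * (z \<bullet> y)) = 2 * (x \<bullet> y)"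
    and inner_B: "x \<in> B \<Longrightarrow> y \<in> B \<Longrightarrow> x \<noteq> y \<Longrightarrow> x \<noteq> - y \<Longrightarrow> x \<bullet> y = 0"
    and inner_BG: "j \<in> J \<Longrightarrow> x \<in> B \<Longrightarrow> y \<in> G j \<Longrightarrow> m * (x \<bullet> y)\<^sup>2 = 1"
begin

section \<open>Kernels on the union of simplices\<close>

definition N :: "'v set" where "N = (\<Union>j\<in>J. G j)"

text \<open>On \<open>N\<close> the kernels 1, \<open>m * a\<close>, \<open>W2\<close> and
  \<open>W3\<close> sum to \<open>card N\<close> times the identity and are, up to this factor,
  orthogonal projections. \<open>W2\<close> belongs to the functions with zero sum on every simplex
  that are orthogonal to the linear ones.\<close>

definition W2 :: "real \<Rightarrow> real" where "W2 a = m * (m * a\<^sup>2 - 1) / 2"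

text \<open>The projection to functions constant on each simplex with total 0. The quadratic factor
  vanishes at the inner products between different simplices; the linear one makes the product minus
  1 equal to \<open>g - 1\<close> at both \<open>1\<close> and \<open>- 1 / m\<close>.\<close>

definition W3 :: "real \<Rightarrow> real" where "W3 a = (m * a\<^sup>2 + 2 * a - 1) * (m * a + 1 - m) / 2 - 1"

text \<open>The analogue on the cross polytope, belonging to the even functions with zero
  sum.\<close>

definition U2 :: "real \<Rightarrow> real" where "U2 a = m * a\<^sup>2 - 1"

abbreviation "g \<equiv> real (card J)"

text \<open>The value 1 would give \<open>(m + 1)\<^sup>2 = m + 1\<close>, impossible for positive
  \<open>m\<close>; hence different simplices share no point.\<close>

lemma inner_G_diff_neq_1:
  assumes "i \<in> J" "j \<in> J" "i \<noteq> j" "x \<in> G i" "y \<in> G j"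
  shows "x \<bullet> y \<noteq> 1"
proof
  assume "x \<bullet> y = 1"
  then have "(m + 1) * m = 0"
    using inner_G_diff[OF assms] by (simp add: power2_eq_square algebra_simps)
  then show False using m_pos by auto
qed

lemma disjoint_G:
  assumes "i \<in> J" "j \<in> J" "i \<noteq> j" shows "G i \<inter> G j = {}"
  using inner_G_diff_neq_1[OF assms] norm_G[OF assms(1)] by (force simp: norm_eq_1)

lemma finite_N: "finite N"
  using finite_J finite_G by (simp add: N_def)

lemma sum_N: "(\<Sum>z\<in>N. f z) = (\<Sum>j\<in>J. \<Sum>z\<in>G j. f z)"
  unfolding N_def using finite_J finite_G disjoint_G by (intro sum.UNION_disjoint) auto

lemma card_N: "real (card N) = g * (m + 1)"
proof -
  have "real (card N) = (\<Sum>z\<in>N. 1)" by simp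
  also have "\<dots> = (\<Sum>j\<in>J. m + 1)"
    unfolding sum_N by (intro sum.cong) (auto simp: card_G)
  finally show ?thesis by simp
qed

lemma N_P: "x \<in> N \<Longrightarrow> x \<in> P"
  using G_P by (auto simp: N_def)

lemma norm_N: "x \<in> N \<Longrightarrow> norm x = 1"
  using norm_G by (auto simp: N_def)

text \<open>This and the next identity are the spherical 2-design property of \<open>N\<close>,
  inherited from the single simplices.\<close>

lemma moment1_N: "x \<in> P \<Longrightarrow> (\<Sum>z\<in>N. x \<bullet> z) = 0"
  by (simp add: sum_N sum_G)

lemma moment2_N: "x \<in> P \<Longrightarrow> y \<in> P \<Longrightarrow> m * (\<Sum>z\<in>N. (x \<bullet> z) * (z \<bullet> y)) = real (card N) * (x \<bullet> y)"
  using m_pos by (simp add: sum_N frame_G card_N)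

lemma W3_N:
  assumes "i \<in> J" "j \<in> J" "x \<in> G i" "y \<in> G j"
  shows "W3 (x \<bullet> y) = g * of_bool (i = j) - 1"
proof -
  have m: "g = (m + 1) / 2" using card_J by simp
  consider "x = y" "i = j" | "i = j" "x \<noteq> y" | "i \<noteq> j"
    using assms disjoint_G by blast
  then show ?thesis
  proof cases
    case 1
    then have "x \<bullet> y = 1" using norm_G[OF assms(1,3)] by (simp add: norm_eq_1)
    then show ?thesis using 1 by (simp add: W3_def m field_simps)
  next
    case 2
    then have "m * (x \<bullet> y) = - 1" using inner_G_same assms by blast
    then have "x \<bullet> y = - 1 / m" using m_pos by (simp add: field_simps)
    moreover have "W3 (- 1 / m) = g - 1"
      using m_pos by (simp add: W3_def m field_simps power2_eq_square)
    ultimately show ?thesis using 2 by simp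
  next
    case 3
    \<comment> \<open>The equation between different simplices, expanded: it says that the quadratic
      factor of \<open>W3\<close> vanishes.\<close>
    have "m * (m * (x \<bullet> y)\<^sup>2 + 2 * (x \<bullet> y) - 1) = 0"
      using inner_G_diff[OF assms(1,2) 3 assms(3,4)] by (simp add: power2_eq_square algebra_simps)
    then show ?thesis using m_pos 3 by (simp add: W3_def)
  qed
qed

lemma W2_N:
  assumes "i \<in> J" "j \<in> J" "x \<in> G i" "y \<in> G j"
  shows "W2 (x \<bullet> y) = g * (m + 1) * of_bool (x = y) - g * of_bool (i = j) - m * (x \<bullet> y)"
proof -
  have m: "g = (m + 1) / 2" using card_J by simp
  consider "x = y" "i = j" | "i = j" "x \<noteq> y" | "i \<noteq> j" "x \<noteq> y"
    using assms disjoint_G by blast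
  then show ?thesis
  proof cases
    case 1
    then have "x \<bullet> y = 1" using norm_G[OF assms(1,3)] by (simp add: norm_eq_1)
    then show ?thesis using 1 by (simp add: W2_def m field_simps)
  next
    case 2
    then have *: "m * (x \<bullet> y) = - 1" using inner_G_same assms by blast
    then have "x \<bullet> y = - 1 / m" using m_pos by (simp add: field_simps)
    moreover have "W2 (- 1 / m) = 1 - g"
      using m_pos by (simp add: W2_def m field_simps power2_eq_square)
    ultimately show ?thesis using 2 * by simp
  next
    case 3
    have "m * (m * (x \<bullet> y)\<^sup>2 + 2 * (x \<bullet> y) - 1) = 0"
      using inner_G_diff[OF assms(1,2) 3(1) assms(3,4)] by (simp add: power2_eq_square algebra_simps)
    \<comment> \<open>The same equation reduces \<open>W2\<close> to a linear expression.\<close>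
    then have "m * (x \<bullet> y)\<^sup>2 = 1 - 2 * (x \<bullet> y)" using m_pos by simp
    then show ?thesis using 3 by (simp add: W2_def)
  qed
qed

text \<open>With arbitrary \<open>f\<close>, all orthogonality relations for \<open>W3\<close>
  become instances, expressed by sums over one simplex and over \<open>N\<close>.\<close>

lemma sum_W3_N:
  assumes "j \<in> J" "y \<in> G j"
  shows "(\<Sum>z\<in>N. f z * W3 (z \<bullet> y)) = g * (\<Sum>z\<in>G j. f z) - (\<Sum>z\<in>N. f z)"
proof -
  have "(\<Sum>z\<in>N. f z * W3 (z \<bullet> y)) = (\<Sum>i\<in>J. \<Sum>z\<in>G i. f z * (g * of_bool (i = j) - 1))"
    unfolding sum_N using assms by (intro sum.cong refl) (simp add: W3_N)
  also have "\<dots> = (\<Sum>i\<in>J. of_bool (i = j) * (g * (\<Sum>z\<in>G i. f z)) - (\<Sum>z\<in>G i. f z))"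
    by (intro sum.cong refl) (simp add: algebra_simps sum_subtractf sum_distrib_left)
  also have "\<dots> = g * (\<Sum>z\<in>G j. f z) - (\<Sum>z\<in>N. f z)"
    using assms finite_J by (simp add: sum_subtractf sum_N of_bool_def if_distrib[of "\<lambda>t. t * _"] cong: if_cong)
  finally show ?thesis .
qed

lemma sum_W2_N:
  assumes "j \<in> J" "y \<in> G j"
  shows "(\<Sum>z\<in>N. f z * W2 (z \<bullet> y)) =
    g * (m + 1) * f y - g * (\<Sum>z\<in>G j. f z) - m * (\<Sum>z\<in>N. f z * (z \<bullet> y))"
proof -
  have y: "y \<in> N" using assms by (auto simp: N_def)
  \<comment> \<open>\<open>W3 (z \<bullet> y) + 1\<close> stands for \<open>g\<close> times the
    indicator of a common simplex, without reference to the index of the simplex of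
    \<open>z\<close>.\<close>
  have *: "W2 (z \<bullet> y) = g * (m + 1) * of_bool (z = y) - (W3 (z \<bullet> y) + 1) - m * (z \<bullet> y)" if "z \<in> N" for z
    using that assms by (auto simp: N_def W2_N W3_N)
  have "(\<Sum>z\<in>N. f z * W2 (z \<bullet> y)) =
      (\<Sum>z\<in>N. g * (m + 1) * (f z * of_bool (z = y)) - f z * W3 (z \<bullet> y) - f z - m * (f z * (z \<bullet> y)))"
    by (intro sum.cong refl) (simp only: *, simp only: algebra_simps mult_1_left mult_1_right)
  also have "\<dots> = g * (m + 1) * (\<Sum>z\<in>N. f z * of_bool (z = y)) - (\<Sum>z\<in>N. f z * W3 (z \<bullet> y))
      - (\<Sum>z\<in>N. f z) - m * (\<Sum>z\<in>N. f z * (z \<bullet> y))"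
    by (simp only: sum_subtractf sum_distrib_left)
  also have "(\<Sum>z\<in>N. f z * of_bool (z = y)) = f y"
    using y finite_N by (simp add: of_bool_def if_distrib[of "\<lambda>t. _ * t"] cong: if_cong)
  finally show ?thesis by (simp add: sum_W3_N[OF assms])
qed

lemma N_E: assumes "y \<in> N" obtains j where "j \<in> J" "y \<in> G j"
  using assms by (auto simp: N_def)

text \<open>The two summation rules with \<open>f\<close> constant or linear: the simplex sums are
  then \<open>m + 1\<close> or 0, and the design identities settle the rest.\<close>

lemma N_orthogonal_low:
  assumes "x \<in> P" "y \<in> N"
  shows "(\<Sum>z\<in>N. W2 (z \<bullet> y)) = 0" "(\<Sum>z\<in>N. W3 (z \<bullet> y)) = 0"
    "(\<Sum>z\<in>N. (x \<bullet> z) * W2 (z \<bullet> y)) = 0" "(\<Sum>z\<in>N. (x \<bullet> z) * W3 (z \<bullet> y)) = 0"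
proof -
  obtain j where j: "j \<in> J" "y \<in> G j" using assms by (elim N_E)
  have y: "y \<in> P" using assms N_P by blast
  have *: "(\<Sum>z\<in>N. z \<bullet> y) = 0" using moment1_N[OF y] by (simp add: inner_commute)
  show "(\<Sum>z\<in>N. W2 (z \<bullet> y)) = 0"
    using sum_W2_N[OF j, of "\<lambda>_. 1"] by (simp add: * card_G[OF j(1)])
  show "(\<Sum>z\<in>N. W3 (z \<bullet> y)) = 0"
    using sum_W3_N[OF j, of "\<lambda>_. 1"] by (simp add: card_N card_G[OF j(1)])
  show "(\<Sum>z\<in>N. (x \<bullet> z) * W2 (z \<bullet> y)) = 0"
    using sum_W2_N[OF j, of "\<lambda>z. x \<bullet> z"] moment2_N[OF assms(1) y] by (simp add: sum_G j(1) assms(1) card_N)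
  show "(\<Sum>z\<in>N. (x \<bullet> z) * W3 (z \<bullet> y)) = 0"
    using sum_W3_N[OF j, of "\<lambda>z. x \<bullet> z"] by (simp add: sum_G j(1) assms(1) moment1_N)
qed

text \<open>Here \<open>f\<close> is itself \<open>W2\<close> or \<open>W3\<close>, so its sums over
  a single simplex are needed: \<open>W3\<close> is constant there, while \<open>W2\<close> sums to
  0.\<close>

lemma N_high:
  assumes "x \<in> N" "y \<in> N"
  shows "(\<Sum>z\<in>N. W2 (x \<bullet> z) * W2 (z \<bullet> y)) = real (card N) * W2 (x \<bullet> y)"
    "(\<Sum>z\<in>N. W2 (x \<bullet> z) * W3 (z \<bullet> y)) = 0"
    "(\<Sum>z\<in>N. W3 (x \<bullet> z) * W2 (z \<bullet> y)) = 0"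
    "(\<Sum>z\<in>N. W3 (x \<bullet> z) * W3 (z \<bullet> y)) = real (card N) * W3 (x \<bullet> y)"
proof -
  obtain i where i: "i \<in> J" "x \<in> G i" using assms by (elim N_E)
  obtain j where j: "j \<in> J" "y \<in> G j" using assms by (elim N_E)
  have P: "x \<in> P" "y \<in> P" using assms N_P by auto
  have low: "(\<Sum>z\<in>N. W2 (x \<bullet> z)) = 0" "(\<Sum>z\<in>N. W3 (x \<bullet> z)) = 0"
      "(\<Sum>z\<in>N. W2 (x \<bullet> z) * (z \<bullet> y)) = 0" "(\<Sum>z\<in>N. W3 (x \<bullet> z) * (z \<bullet> y)) = 0"
    using N_orthogonal_low[OF P(2) assms(1)] by (simp_all add: inner_commute mult.commute)
  have G3: "(\<Sum>z\<in>G j. W3 (x \<bullet> z)) = (m + 1) * W3 (x \<bullet> y)"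
    using i j by (simp add: W3_N card_G)
  have "(\<Sum>z\<in>G j. W2 (x \<bullet> z)) =
      (\<Sum>z\<in>G j. g * (m + 1) * of_bool (x = z) - g * of_bool (i = j) - m * (x \<bullet> z))"
    using i j by (intro sum.cong refl) (simp add: W2_N)
  also have "\<dots> = g * (m + 1) * (\<Sum>z\<in>G j. of_bool (x = z)) - (m + 1) * g * of_bool (i = j)"
    using j P by (simp add: sum_subtractf sum_G card_G flip: sum_distrib_left)
  also have "(\<Sum>z\<in>G j. of_bool (x = z)) = (of_bool (i = j) :: real)"
    using finite_G[OF j(1)] i j disjoint_G[of i j] by (auto simp: of_bool_def)
  finally have G2: "(\<Sum>z\<in>G j. W2 (x \<bullet> z)) = 0" by simp
  show "(\<Sum>z\<in>N. W2 (x \<bullet> z) * W2 (z \<bullet> y)) = real (card N) * W2 (x \<bullet> y)"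
    using sum_W2_N[OF j, of "\<lambda>z. W2 (x \<bullet> z)"] by (simp add: G2 low card_N)
  show "(\<Sum>z\<in>N. W2 (x \<bullet> z) * W3 (z \<bullet> y)) = 0"
    using sum_W3_N[OF j, of "\<lambda>z. W2 (x \<bullet> z)"] by (simp add: G2 low)
  show "(\<Sum>z\<in>N. W3 (x \<bullet> z) * W3 (z \<bullet> y)) = real (card N) * W3 (x \<bullet> y)"
    using sum_W3_N[OF j, of "\<lambda>z. W3 (x \<bullet> z)"] by (simp add: G3 low card_N)
  show "(\<Sum>z\<in>N. W3 (x \<bullet> z) * W2 (z \<bullet> y)) = 0"
    using sum_W2_N[OF j, of "\<lambda>z. W3 (x \<bullet> z)"] by (simp add: G3 low)
qed

section \<open>Kernels on the cross polytope\<close>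

lemma sum_B_uminus: "(\<Sum>z\<in>B. f (- z)) = (\<Sum>z\<in>B. f z)"
  by (rule sum.reindex_bij_witness[of _ uminus uminus]) (auto simp: uminus_B)

lemma sum_B_odd:
  fixes f :: "'v \<Rightarrow> real"
  assumes "\<And>z. f (- z) = - f z" shows "(\<Sum>z\<in>B. f z) = 0"
  using sum_B_uminus[of f] assms by (simp add: sum_negf)

lemma moment1_B: "(\<Sum>z\<in>B. x \<bullet> z) = 0"
  by (intro sum_B_odd) simp

lemma moment2_B: "x \<in> P \<Longrightarrow> y \<in> P \<Longrightarrow> m * (\<Sum>z\<in>B. (x \<bullet> z) * (z \<bullet> y)) = real (card B) * (x \<bullet> y)"
  by (simp add: frame_B card_B)

text \<open>\<open>U2\<close> is even, so its product with a linear function is odd; the constant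
  case is the frame identity with \<open>y\<close> taken twice.\<close>

lemma B_orthogonal_low:
  shows "y \<in> B \<Longrightarrow> (\<Sum>z\<in>B. U2 (z \<bullet> y)) = 0"
    and "(\<Sum>z\<in>B. (x \<bullet> z) * U2 (z \<bullet> y)) = 0"
proof -
  show "(\<Sum>z\<in>B. U2 (z \<bullet> y)) = 0" if y: "y \<in> B"
  proof -
    have "(\<Sum>z\<in>B. (z \<bullet> y)\<^sup>2) = 2"
      using frame_B[OF B_P[OF y] B_P[OF y]] norm_B[OF y]
      by (simp add: inner_commute power2_eq_square norm_eq_1)
    then show ?thesis by (simp add: U2_def sum_subtractf card_B flip: sum_distrib_left)
  qed
  show "(\<Sum>z\<in>B. (x \<bullet> z) * U2 (z \<bullet> y)) = 0"
    by (intro sum_B_odd) (simp add: U2_def)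
qed

lemma U2_B: "x \<in> B \<Longrightarrow> z \<in> B \<Longrightarrow> U2 (x \<bullet> z) = m * (of_bool (z = x) + of_bool (z = - x)) - 1"
proof -
  assume xz: "x \<in> B" "z \<in> B"
  then have 1: "x \<bullet> x = 1" using norm_B[of x] by (simp add: norm_eq_1)
  \<comment> \<open>Keeps the two indicators from being 1 at the same point.\<close>
  then have "x \<noteq> - x"
    by (metis inner_minus_left neg_equal_iff_equal neg_equal_zero zero_neq_one)
  moreover consider "z = x" | "z = - x" | "z \<noteq> x" "x \<noteq> - z" by fastforce
  ultimately show ?thesis
    using inner_B[OF xz] 1 by cases (auto simp: U2_def)
qed

text \<open>Apart from a vanishing sum only \<open>z = x\<close> and \<open>z = - x\<close>
  contribute, equally because \<open>U2\<close> is even; this gives the factor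
  \<open>2 * m\<close>.\<close>

lemma B_high:
  assumes "x \<in> B" "y \<in> B"
  shows "(\<Sum>z\<in>B. U2 (x \<bullet> z) * U2 (z \<bullet> y)) = real (card B) * U2 (x \<bullet> y)"
proof -
  have "(\<Sum>z\<in>B. U2 (x \<bullet> z) * U2 (z \<bullet> y)) =
      (\<Sum>z\<in>B. m * (of_bool (z = x) * U2 (z \<bullet> y)) + m * (of_bool (z = - x) * U2 (z \<bullet> y)) - U2 (z \<bullet> y))"
    using assms by (intro sum.cong refl) (simp add: U2_B[of x] algebra_simps)
  also have "\<dots> = m * (\<Sum>z\<in>B. of_bool (z = x) * U2 (z \<bullet> y)) + m * (\<Sum>z\<in>B. of_bool (z = - x) * U2 (z \<bullet> y))"
    by (simp add: sum_subtractf sum.distrib B_orthogonal_low(1)[OF assms(2)] flip: sum_distrib_left)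
  also have "(\<Sum>z\<in>B. of_bool (z = x) * U2 (z \<bullet> y)) = U2 (x \<bullet> y)"
    using assms finite_B by (simp add: of_bool_def if_distrib[of "\<lambda>t. t * _"] cong: if_cong)
  also have "(\<Sum>z\<in>B. of_bool (z = - x) * U2 (z \<bullet> y)) = U2 (- x \<bullet> y)"
    using assms uminus_B finite_B by (simp add: of_bool_def if_distrib[of "\<lambda>t. t * _"] cong: if_cong)
  finally show ?thesis by (simp add: card_B U2_def)
qed

section \<open>The three codes and their common kernels\<close>

definition code :: "nat \<Rightarrow> 'v set" where
  "code k = (if k = 1 then N else if k = 2 then B else uminus ` N)"

text \<open>The sign carrying \<open>N\<close> onto \<open>code k\<close> for \<open>k\<close> equal
  to 1 or 3.\<close>

definition \<eta> :: "nat \<Rightarrow> real" where "\<eta> k = (if k = 3 then - 1 else 1)"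

text \<open>The third code is the negative of the first, so for degrees other than one the kernels
  between them are those of the first code evaluated at \<open>\<eta> i * \<eta> j\<close> times the inner product.  For
  \<open>l = 1\<close> the sign is left out, since the kernel of degree one has to be the same multiple of the
  inner product in all blocks.  Values with \<open>l > 3\<close>, with \<open>l > 2\<close> in the middle block, or with \<open>l > 1\<close>
  in the blocks between the middle code and the other two, are never used.\<close>

definition V :: "nat \<Rightarrow> nat \<Rightarrow> nat \<Rightarrow> real poly" where
  "V i j l =
    (if l = 0 then 1 else if l = 1 then [:0, m:]
     else if i = 2 \<or> j = 2 then [:- 1, 0, m:]
     else if l = 2 then [:- m / 2, 0, m\<^sup>2 / 2:]
     else [:(m - 3) / 2, \<eta> i * \<eta> j * (2 - 3 * m) / 2, m * (3 - m) / 2, \<eta> i * \<eta> j * m\<^sup>2 / 2:])"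

lemma \<eta>_square: "\<eta> k * \<eta> k = 1" "\<eta> k * (\<eta> k * a) = a"
  by (simp_all add: \<eta>_def)

lemma \<eta>_cases: "\<eta> k = 1 \<or> \<eta> k = - 1"
  by (simp add: \<eta>_def)

text \<open>In degrees two and three outside the middle, the coefficients of \<open>V\<close> are
  those of \<open>W2\<close> and \<open>W3\<close> expanded; a sign in the argument affects odd
  powers only, which is where \<open>V\<close> carries \<open>\<eta> i * \<eta> j\<close>.\<close>

lemma poly_V:
  "poly (V i j 0) a = 1"
  "poly (V i j (Suc 0)) a = m * a"
  "i = 2 \<or> j = 2 \<Longrightarrow> 2 \<le> l \<Longrightarrow> poly (V i j l) a = U2 a"
  "i \<noteq> 2 \<Longrightarrow> j \<noteq> 2 \<Longrightarrow> poly (V i j 2) a = W2 (\<eta> i * (\<eta> j * a))"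
  "i \<noteq> 2 \<Longrightarrow> j \<noteq> 2 \<Longrightarrow> poly (V i j 3) a = W3 (\<eta> i * (\<eta> j * a))"
proof -
  show "poly (V i j 0) a = 1" "poly (V i j (Suc 0)) a = m * a"
    by (simp_all add: V_def)
  show "poly (V i j l) a = U2 a" if "i = 2 \<or> j = 2" "2 \<le> l"
    using that by (auto simp: V_def U2_def power2_eq_square)
  show "poly (V i j 2) a = W2 (\<eta> i * (\<eta> j * a))" if "i \<noteq> 2" "j \<noteq> 2"
    using that \<eta>_cases[of i] \<eta>_cases[of j] by (auto simp: V_def W2_def power2_eq_square field_simps)
  show "poly (V i j 3) a = W3 (\<eta> i * (\<eta> j * a))" if "i \<noteq> 2" "j \<noteq> 2"
    using that \<eta>_cases[of i] \<eta>_cases[of j] by (auto simp: V_def W3_def power2_eq_square field_simps)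
qed

lemma V_commute: "V i j l = V j i l"
  by (simp add: V_def disj_commute mult.commute[of "\<eta> i" "\<eta> j"])

lemma code_N: "k \<in> {1, 2, 3} \<Longrightarrow> k \<noteq> 2 \<Longrightarrow> code k = (\<lambda>x. \<eta> k *\<^sub>R x) ` N"
  by (auto simp: code_def \<eta>_def image_iff)

lemma code_B: "code 2 = B"
  by (simp add: code_def)

lemma finite_code: "finite (code k)"
  using finite_N finite_B by (simp add: code_def)

lemma code_P: "x \<in> code k \<Longrightarrow> x \<in> P"
  using N_P B_P uminus_P by (auto simp: code_def split: if_splits)

lemma norm_code: "x \<in> code k \<Longrightarrow> norm x = 1"
  using norm_N norm_B by (auto simp: code_def split: if_splits)

lemma code_N_mem:
  assumes "k \<in> {1, 2, 3}" "k \<noteq> 2" "x \<in> code k" shows "\<eta> k *\<^sub>R x \<in> N"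
  using assms(3) unfolding code_N[OF assms(1,2)] by (auto simp: \<eta>_square)

lemma inj_\<eta>: "inj_on (\<lambda>x :: 'v. \<eta> k *\<^sub>R x) A"
  by (auto simp: inj_on_def \<eta>_def)

lemma card_code_N:
  assumes "k \<in> {1, 2, 3}" "k \<noteq> 2" shows "card (code k) = card N"
  unfolding code_N[OF assms] by (rule card_image[OF inj_\<eta>])

lemma sum_code_N:
  assumes "k \<in> {1, 2, 3}" "k \<noteq> 2" shows "(\<Sum>z\<in>code k. f z) = (\<Sum>z\<in>N. f (\<eta> k *\<^sub>R z))"
  unfolding code_N[OF assms] by (simp add: sum.reindex[OF inj_\<eta>])

section \<open>Moments and convolutions across the codes\<close>

lemma moment1_code:
  assumes "k \<in> {1, 2, 3}" "x \<in> P" shows "(\<Sum>z\<in>code k. x \<bullet> z) = 0"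
proof (cases "k = 2")
  case True
  then show ?thesis by (simp add: code_B moment1_B)
next
  case False
  then show ?thesis using assms
    by (simp add: sum_code_N moment1_N flip: sum_distrib_left)
qed

lemma moment2_code:
  assumes "k \<in> {1, 2, 3}" "x \<in> P" "y \<in> P"
  shows "m * (\<Sum>z\<in>code k. (x \<bullet> z) * (z \<bullet> y)) = real (card (code k)) * (x \<bullet> y)"
proof (cases "k = 2")
  case True
  then show ?thesis using assms by (simp add: code_B moment2_B)
next
  case False
  have "(\<Sum>z\<in>code k. (x \<bullet> z) * (z \<bullet> y)) = (\<Sum>z\<in>N. (x \<bullet> z) * (z \<bullet> y))"
    unfolding sum_code_N[OF assms(1) False] by (intro sum.cong refl) (simp add: \<eta>_square mult.left_commute)
  then show ?thesis
    using assms False by (simp only: moment2_N card_code_N[OF assms(1) False])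
qed

text \<open>Exactly the 2-design property of \<open>code j\<close>; the outer points enter only
  through \<open>P\<close>.\<close>

lemma convolution_low:
  assumes "j \<in> {1, 2, 3}" "x \<in> P" "y \<in> P" "l \<le> 1" "l' \<le> 1"
  shows "(\<Sum>z\<in>code j. poly (V i j l) (x \<bullet> z) * poly (V j k l') (z \<bullet> y)) =
    (if l = l' then card (code j) * poly (V i k l) (x \<bullet> y) else 0)"
proof -
  have mom: "(\<Sum>z\<in>code j. x \<bullet> z) = 0" "(\<Sum>z\<in>code j. z \<bullet> y) = 0"
    using moment1_code[OF assms(1,2)] moment1_code[OF assms(1,3)]
    by (simp_all add: inner_commute[of _ y])
  have "(\<Sum>z\<in>code j. m * (x \<bullet> z) * (m * (z \<bullet> y))) = m * (m * (\<Sum>z\<in>code j. (x \<bullet> z) * (z \<bullet> y)))"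
    by (simp add: sum_distrib_left mult_ac)
  then have "(\<Sum>z\<in>code j. m * (x \<bullet> z) * (m * (z \<bullet> y))) = card (code j) * (m * (x \<bullet> y))"
    using moment2_code[OF assms(1-3)] by simp
  moreover have "l = 0 \<or> l = Suc 0" "l' = 0 \<or> l' = Suc 0"
    using assms by auto
  ultimately show ?thesis
    by (auto simp: poly_V mom simp flip: sum_distrib_left)
qed

text \<open>Only the high kernel needs \<open>j\<close> and \<open>k\<close> to be of the same kind;
  the other one is constant or linear, so \<open>x\<close> is just a vector of
  \<open>P\<close>.\<close>

lemma convolution_mixed:
  assumes j: "j \<in> {1, 2, 3}" and k: "k \<in> {1, 2, 3}" and jk: "j = 2 \<longleftrightarrow> k = 2"
    and x: "x \<in> P" and y: "y \<in> code k" and l: "l \<le> 1" "2 \<le> l'" "l' \<le> 3"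
  shows "(\<Sum>z\<in>code j. poly (V i j l) (x \<bullet> z) * poly (V j k l') (z \<bullet> y)) = 0"
proof (cases "j = 2")
  case True
  then have "y \<in> B" "k = 2" using jk y by (auto simp: code_B)
  moreover have "l = 0 \<or> l = Suc 0" using l by auto
  ultimately show ?thesis using True l B_orthogonal_low(1)[of y] B_orthogonal_low(2)[of x y]
    by (auto simp: code_B poly_V mult.assoc simp flip: sum_distrib_left)
next
  case False
  then have k2: "k \<noteq> 2" using jk by simp
  define y' where "y' = \<eta> k *\<^sub>R y"
  have y': "y' \<in> N" unfolding y'_def using code_N_mem[OF k k2 y] .
  \<comment> \<open>The sign of \<open>code j\<close> occurs twice and cancels; that of
    \<open>code k\<close> moves into \<open>y'\<close>.\<close>
  have V: "poly (V j k 2) (\<eta> j * (z \<bullet> y)) = W2 (z \<bullet> y')" "poly (V j k 3) (\<eta> j * (z \<bullet> y)) = W3 (z \<bullet> y')" for z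
    using False k2 by (simp_all add: poly_V y'_def \<eta>_square mult.left_commute)
  have "l = 0 \<or> l = Suc 0" using l by auto
  moreover have "l' = 2 \<or> l' = 3" using l by auto
  ultimately show ?thesis
    unfolding sum_code_N[OF j False] using N_orthogonal_low[OF x y']
    by (elim disjE) (simp_all add: V poly_V(1,2) mult.assoc flip: sum_distrib_left)
qed

text \<open>Replacing points by their representatives in \<open>N\<close> removes all signs and
  leaves \<open>N_high\<close>; in the middle block \<open>B_high\<close> applies.\<close>

lemma convolution_high:
  assumes i: "i \<in> {1, 2, 3}" and j: "j \<in> {1, 2, 3}" and k: "k \<in> {1, 2, 3}"
    and ijk: "i = 2 \<longleftrightarrow> j = 2" "j = 2 \<longleftrightarrow> k = 2"
    and x: "x \<in> code i" and y: "y \<in> code k"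
    and l: "2 \<le> l" "l \<le> 3" "2 \<le> l'" "l' \<le> 3" "j = 2 \<Longrightarrow> l \<le> 2 \<and> l' \<le> 2"
  shows "(\<Sum>z\<in>code j. poly (V i j l) (x \<bullet> z) * poly (V j k l') (z \<bullet> y)) =
    (if l = l' then card (code j) * poly (V i k l) (x \<bullet> y) else 0)"
proof (cases "j = 2")
  case True
  \<comment> \<open>In the middle block only degree two is left, so \<open>l\<close> and
    \<open>l'\<close> agree.\<close>
  then have "x \<in> B" "y \<in> B" "i = 2" "k = 2" "l = l'"
    using ijk x y l by (auto simp: code_B)
  then show ?thesis using True l by (simp add: poly_V code_B B_high)
next
  case False
  then have i2: "i \<noteq> 2" and k2: "k \<noteq> 2" using ijk by simp_all
  define x' where "x' = \<eta> i *\<^sub>R x"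
  define y' where "y' = \<eta> k *\<^sub>R y"
  have y': "y' \<in> N" unfolding y'_def using code_N_mem[OF k k2 y] .
  have x': "x' \<in> N" unfolding x'_def using code_N_mem[OF i i2 x] .
  have V1: "poly (V i j 2) (\<eta> j * (x \<bullet> z)) = W2 (x' \<bullet> z)" "poly (V i j 3) (\<eta> j * (x \<bullet> z)) = W3 (x' \<bullet> z)" for z
    using False i2 by (simp_all add: poly_V x'_def \<eta>_square)
  have V2: "poly (V j k 2) (\<eta> j * (z \<bullet> y)) = W2 (z \<bullet> y')" "poly (V j k 3) (\<eta> j * (z \<bullet> y)) = W3 (z \<bullet> y')" for z
    using False k2 by (simp_all add: poly_V y'_def \<eta>_square mult.left_commute)
  have V3: "poly (V i k 2) (x \<bullet> y) = W2 (x' \<bullet> y')" "poly (V i k 3) (x \<bullet> y) = W3 (x' \<bullet> y')"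
    using i2 k2 by (simp_all add: poly_V x'_def y'_def \<eta>_square mult.left_commute)
  have "l = 2 \<or> l = 3" "l' = 2 \<or> l' = 3" using l by auto
  then show ?thesis
    unfolding sum_code_N[OF j False] card_code_N[OF j False] using N_high[OF x' y']
    by (elim disjE) (simp_all add: V1 V2 V3)
qed

section \<open>Number of inner products in each block\<close>

lemma two_points_N: obtains x y where "x \<in> N" "y \<in> N" "x \<bullet> x = 1" "x \<bullet> y \<noteq> 1"
proof -
  have "card J \<noteq> 0" using card_J m_pos by auto
  then obtain j where j: "j \<in> J" by (auto simp: card_eq_0_iff)
  have "1 < card (G j)"
    using card_G[OF j] m_pos by linarith
  then obtain x y where xy: "x \<in> G j" "y \<in> G j" "x \<noteq> y"
    by (metis card_le_Suc0_iff_eq finite_G[OF j] not_less One_nat_def)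
  then have "m * (x \<bullet> y) = - 1" using inner_G_same[OF j] by blast
  then have "x \<bullet> y \<noteq> 1" using m_pos by auto
  then show ?thesis using that[of x y] xy j norm_G[OF j xy(1)] by (auto simp: N_def norm_eq_1)
qed

lemma nonempty_B: "B \<noteq> {}"
  using card_B m_pos by auto

lemma nonempty_code: "k \<in> {1, 2, 3} \<Longrightarrow> code k \<noteq> {}"
  using nonempty_B two_points_N by (auto simp: code_def)

lemma inner_products_N:
  assumes "i \<in> {1, 2, 3}" "j \<in> {1, 2, 3}" "i \<noteq> 2" "j \<noteq> 2"
  shows "inner_products (code i) (code j) = (\<lambda>t. \<eta> i * \<eta> j * t) ` inner_products N N"
proof (intro equalityI subsetI)
  fix t assume "t \<in> inner_products (code i) (code j)"
  then obtain x y where "t = (\<eta> i *\<^sub>R x) \<bullet> (\<eta> j *\<^sub>R y)" "x \<in> N" "y \<in> N"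
    unfolding code_N[OF assms(1,3)] code_N[OF assms(2,4)] inner_products_def by blast
  then show "t \<in> (\<lambda>t. \<eta> i * \<eta> j * t) ` inner_products N N"
    using inner_productsI[of x N y N] by (simp add: image_iff mult.assoc) blast
next
  fix t assume "t \<in> (\<lambda>t. \<eta> i * \<eta> j * t) ` inner_products N N"
  then obtain x y where "t = \<eta> i * \<eta> j * (x \<bullet> y)" "x \<in> N" "y \<in> N"
    by (auto simp: inner_products_def)
  then have "t = (\<eta> i *\<^sub>R x) \<bullet> (\<eta> j *\<^sub>R y)" "\<eta> i *\<^sub>R x \<in> code i" "\<eta> j *\<^sub>R y \<in> code j"
    unfolding code_N[OF assms(1,3)] code_N[OF assms(2,4)] by (auto simp: mult.assoc)
  then show "t \<in> inner_products (code i) (code j)"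
    using inner_productsI by blast
qed

lemma inner_degree_N:
  assumes "i \<in> {1, 2, 3}" "j \<in> {1, 2, 3}" "i \<noteq> 2" "j \<noteq> 2"
  shows "inner_degree (code i) (code j) = inner_degree N N"
proof -
  have "inj_on (\<lambda>t. \<eta> i * \<eta> j * t) (inner_products N N)"
    by (auto simp: inj_on_def \<eta>_def)
  then show ?thesis
    unfolding inner_degree_def inner_products_N[OF assms] by (simp add: card_image)
qed

text \<open>Two values occur inside a simplex and two are the roots of the equation in
  \<open>inner_G_diff\<close>. This is only a bound, since a single simplex attains fewer.\<close>

lemma inner_degree_N_le: "inner_degree N N \<le> 3"
proof (rule inner_degree_le)
  let ?S = "{1, - 1 / m, (sqrt (m + 1) - 1) / m, (- sqrt (m + 1) - 1) / m}"
  show "finite ?S" by simp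
  show "card ?S \<le> Suc 3" by (simp add: card_insert_if)
  show "inner_products N N \<subseteq> ?S"
  proof
    fix t assume "t \<in> inner_products N N"
    then obtain x y i j where *: "t = x \<bullet> y" "i \<in> J" "j \<in> J" "x \<in> G i" "y \<in> G j"
      by (auto simp: inner_products_def N_def)
    consider "x = y" | "i = j" "x \<noteq> y" | "i \<noteq> j" by blast
    then show "t \<in> ?S"
    proof cases
      case 1
      then show ?thesis using * norm_G[of i x] by (simp add: norm_eq_1)
    next
      case 2
      then have "m * t = - 1" using * inner_G_same by blast
      then have "t = - 1 / m" using m_pos by (simp add: field_simps)
      then show ?thesis by blast
    next
      case 3
      then have "(m * t + 1)\<^sup>2 = (sqrt (m + 1))\<^sup>2" using * inner_G_diff[of i j x y] m_pos by simp
      then have "m * t + 1 = sqrt (m + 1) \<or> m * t + 1 = - sqrt (m + 1)"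
        by (simp only: power2_eq_iff)
      then have "t = (sqrt (m + 1) - 1) / m \<or> t = (- sqrt (m + 1) - 1) / m"
        using m_pos by (auto simp: field_simps)
      then show ?thesis by blast
    qed
  qed
qed

lemma inner_degree_B_le: "inner_degree B B \<le> 2"
proof (rule inner_degree_le)
  show "inner_products B B \<subseteq> {1, - 1, 0}"
    using inner_B norm_B by (fastforce simp: inner_products_def norm_eq_1)
qed auto

lemma inner_B_code:
  assumes "j \<in> {1, 2, 3}" "j \<noteq> 2" "x \<in> B" "y \<in> code j"
  shows "m * (x \<bullet> y)\<^sup>2 = 1"
proof -
  obtain i where "i \<in> J" "\<eta> j *\<^sub>R y \<in> G i"
    using code_N_mem[OF assms(1,2,4)] by (elim N_E)
  then have "m * (x \<bullet> \<eta> j *\<^sub>R y)\<^sup>2 = 1"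
    by (rule inner_BG[OF _ assms(3)])
  then show ?thesis using \<eta>_cases[of j] by auto
qed

text \<open>All inner products have square \<open>1 / m\<close>, and both signs occur because
  \<open>B\<close> is antipodal.\<close>

lemma inner_degree_BN:
  assumes "j \<in> {1, 2, 3}" "j \<noteq> 2"
  shows "inner_degree B (code j) = 1"
proof (rule antisym)
  show "inner_degree B (code j) \<le> 1"
  proof (rule inner_degree_le)
    show "inner_products B (code j) \<subseteq> {1 / sqrt m, - (1 / sqrt m)}"
    proof
      fix t assume "t \<in> inner_products B (code j)"
      then have "m * t\<^sup>2 = 1"
        using inner_B_code[OF assms] by (auto simp: inner_products_def)
      then have "t\<^sup>2 = (1 / sqrt m)\<^sup>2"
        using m_pos by (simp add: power_divide field_simps)
      then show "t \<in> {1 / sqrt m, - (1 / sqrt m)}"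
        unfolding power2_eq_iff by blast
    qed
  qed (auto simp: card_insert_if)
  obtain x y where xy: "x \<in> B" "y \<in> code j"
    using nonempty_B nonempty_code assms by blast
  then have "x \<bullet> y \<noteq> 0" using inner_B_code[OF assms] by fastforce
  then have "x \<bullet> y \<noteq> - x \<bullet> y" by simp
  moreover have "x \<bullet> y \<in> inner_products B (code j)" "- x \<bullet> y \<in> inner_products B (code j)"
    using inner_productsI uminus_B xy by blast+
  ultimately show "1 \<le> inner_degree B (code j)"
    using inner_degree_ge_1[OF finite_B finite_code] by blast
qed

lemma inner_degree_NB:
  assumes "j \<in> {1, 2, 3}" "j \<noteq> 2" shows "inner_degree (code j) B = 1"
  by (subst inner_degree_commute) (rule inner_degree_BN[OF assms])

text \<open>Makes degree one available in every block, as the transitivity of index ranges requires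
  for \<open>l \<le> 1\<close>.\<close>

lemma inner_degree_ge:
  assumes "i \<in> {1, 2, 3}" "j \<in> {1, 2, 3}"
  shows "1 \<le> inner_degree (code i) (code j)"
proof -
  consider "i = 2" "j = 2" | "i = 2" "j \<noteq> 2" | "i \<noteq> 2" "j = 2" | "i \<noteq> 2" "j \<noteq> 2" by blast
  then show ?thesis
  proof cases
    case 1
    obtain x where "x \<in> B" using nonempty_B by blast
    then have "1 \<in> inner_products B B" "- 1 \<in> inner_products B B"
      using uminus_B norm_B by (force simp: inner_products_def norm_eq_1)+
    then show ?thesis unfolding 1 code_B
      by (rule inner_degree_ge_1[OF finite_B finite_B]) simp
  next
    case 2
    then show ?thesis using inner_degree_BN assms by (simp add: code_B)
  next
    case 3
    then show ?thesis using inner_degree_NB assms by (simp add: code_B)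
  next
    case 4
    obtain x y where xy: "x \<in> N" "y \<in> N" "x \<bullet> x = 1" "x \<bullet> y \<noteq> 1" by (rule two_points_N)
    then have "x \<bullet> x \<in> inner_products N N" "x \<bullet> y \<in> inner_products N N" "x \<bullet> x \<noteq> x \<bullet> y"
      by (metis inner_productsI)+
    then show ?thesis
      unfolding inner_degree_N[OF assms 4] by (rule inner_degree_ge_1[OF finite_N finite_N])
  qed
qed

text \<open>A block between the middle code and an outer one has only two inner products, so higher
  degrees occur only between codes of the same kind.\<close>

lemma inner_degree_ge_2:
  assumes "i \<in> {1, 2, 3}" "j \<in> {1, 2, 3}" "2 \<le> l" "l \<le> inner_degree (code i) (code j)"
  shows "i = 2 \<longleftrightarrow> j = 2" "l \<le> 3" "j = 2 \<Longrightarrow> l \<le> 2"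
proof -
  show ij: "i = 2 \<longleftrightarrow> j = 2"
  proof (rule ccontr)
    assume "\<not> (i = 2 \<longleftrightarrow> j = 2)"
    then consider "i = 2" "j \<noteq> 2" | "i \<noteq> 2" "j = 2" by blast
    then have "inner_degree (code i) (code j) = 1"
    proof cases
      case 1
      then show ?thesis using inner_degree_BN[OF assms(2) 1(2)] by (simp only: 1(1) code_B)
    next
      case 2
      then show ?thesis using inner_degree_NB[OF assms(1) 2(1)] by (simp only: 2(2) code_B)
    qed
    then show False using assms(3,4) by simp
  qed
  show "j = 2 \<Longrightarrow> l \<le> 2"
    using ij assms(4) inner_degree_B_le by (simp add: code_B)
  show "l \<le> 3"
  proof (cases "j = 2")
    case True
    then show ?thesis using ij assms(4) inner_degree_B_le by (simp add: code_B)
  next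
    case False
    then show ?thesis
      using ij assms(4) inner_degree_N_le inner_degree_N[OF assms(1,2)] by simp
  qed
qed

section \<open>Verification of the kernel axioms\<close>

lemma degree_V:
  assumes "l \<le> 3" "i = 2 \<or> j = 2 \<Longrightarrow> l \<le> 2"
  shows "degree (V i j l) = l"
proof -
  consider "l = 0" | "l = 1" | "l = 2" | "l = 3" using assms(1) by linarith
  then show ?thesis
    using assms m_pos \<eta>_cases[of i] \<eta>_cases[of j] by cases (auto simp: V_def)
qed

sublocale inner_product_kernels "{1, 2, 3}" code V m
proof
  fix i j k l l' :: nat and x y :: 'v
  show "finite {1, 2, 3 :: nat}" by simp
  show "finite (code k)" by (rule finite_code)
  show "k \<in> {1, 2, 3} \<Longrightarrow> code k \<noteq> {}" by (rule nonempty_code)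
  show "x \<in> code k \<Longrightarrow> norm x = 1" by (rule norm_code)
  show "m \<noteq> 0" using m_pos by simp
  show "V i j 0 = 1" "V i j (Suc 0) = [:0, m:]" by (simp_all add: V_def)
  show "V i j l = V j i l" by (rule V_commute)
  assume i: "i \<in> {1, 2, 3}" and j: "j \<in> {1, 2, 3}" and l: "l \<le> inner_degree (code i) (code j)"
  show "degree (V i j l) = l"
    using inner_degree_ge_2[OF i j _ l] by (intro degree_V) (cases "2 \<le> l"; auto)+
  assume k: "k \<in> {1, 2, 3}"
  show "l \<le> inner_degree (code i) (code k)" if "l \<le> inner_degree (code j) (code k)"
  \<comment> \<open>From degree two on, all three codes are of the same kind, and blocks of one kind
    have equal inner degree.\<close>
  proof (cases "2 \<le> l")
    case True
    note ij = inner_degree_ge_2(1)[OF i j True l] and jk = inner_degree_ge_2(1)[OF j k True that]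
    show ?thesis
    proof (cases "j = 2")
      case True
      then show ?thesis using ij jk l by simp
    next
      case False
      then have "i \<noteq> 2" "k \<noteq> 2" using ij jk by simp_all
      then show ?thesis
        using l inner_degree_N[OF i j _ False] inner_degree_N[OF i k] by simp
    qed
  next
    case False
    then show ?thesis using inner_degree_ge[OF i k] by linarith
  qed
  assume l': "l' \<le> inner_degree (code j) (code k)" and x: "x \<in> code i" and y: "y \<in> code k"
  have P: "x \<in> P" "y \<in> P" using x y code_P by auto
  note ij = inner_degree_ge_2[OF i j _ l] and jk = inner_degree_ge_2[OF j k _ l']
  consider "l \<le> 1" "l' \<le> 1" | "l \<le> 1" "2 \<le> l'" | "2 \<le> l" "l' \<le> 1" | "2 \<le> l" "2 \<le> l'" by linarith
  then show "(\<Sum>z\<in>code j. poly (V i j l) (x \<bullet> z) * poly (V j k l') (z \<bullet> y)) =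
        (if l = l' then card (code j) * poly (V i k l) (x \<bullet> y) else 0)"
  proof cases
    case 1
    then show ?thesis by (rule convolution_low[OF j P])
  next
    case 2
    then show ?thesis using convolution_mixed[OF j k jk(1) P(1) y 2 jk(2)] by simp
  next
    case 3
    \<comment> \<open>The transposed form of the previous case, as \<open>V\<close> and the inner
      product are symmetric.\<close>
    have "(\<Sum>z\<in>code j. poly (V k j l') (y \<bullet> z) * poly (V j i l) (z \<bullet> x)) = 0"
      using ij 3 by (intro convolution_mixed[OF j i _ P(2) x]) auto
    then have "(\<Sum>z\<in>code j. poly (V i j l) (x \<bullet> z) * poly (V j k l') (z \<bullet> y)) = 0"
      by (simp add: V_commute[of k j] V_commute[of j i] inner_commute mult.commute)
    then show ?thesis using 3 by simp
  next
    case 4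
    then show ?thesis using ij jk by (intro convolution_high[OF i j k _ _ x y]) auto
  qed
qed

end

section \<open>Derived codes of a maximal real MUB\<close>

lemma orthonormal_basis_finite: "orthonormal_basis S \<Longrightarrow> finite S"
  for S :: "(real ^ 'n) set"
  using independent_imp_finite by (auto simp: orthonormal_basis_def)

lemma orthonormal_basis_card:
  fixes S :: "(real ^ 'n) set"
  assumes "orthonormal_basis S" shows "card S = CARD('n)"
proof -
  have "card S = dim (span S)"
    using assms dim_span_eq_card_independent by (metis orthonormal_basis_def)
  also have "span S = UNIV"
    using assms by (simp add: orthonormal_basis_def)
  finally show ?thesis by (simp add: dim_UNIV)
qed

lemma orthonormal_basis_parseval:
  fixes S :: "(real ^ 'n) set"
  assumes "orthonormal_basis S"
  shows "(\<Sum>z\<in>S. (x \<bullet> z) * (z \<bullet> y)) = x \<bullet> y"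
proof -
  have "x = (\<Sum>z\<in>S. (x \<bullet> z) *\<^sub>R z)"
    using assms orthonormal_basis_finite[OF assms]
    by (intro orthonormal_basis_expand[symmetric]) (auto simp: orthonormal_basis_def)
  then have "x \<bullet> y = (\<Sum>z\<in>S. (x \<bullet> z) *\<^sub>R z) \<bullet> y" by (rule arg_cong)
  then show ?thesis by (simp add: inner_sum_left)
qed

lemma orthonormal_basis_inner:
  "orthonormal_basis S \<Longrightarrow> x \<in> S \<Longrightarrow> y \<in> S \<Longrightarrow> x \<bullet> y = of_bool (x = y)"
  by (auto simp: orthonormal_basis_def pairwise_def orthogonal_def norm_eq_1)

text \<open>\<open>p\<close> need not belong to the basis \<open>M i\<^sub>0\<close> itself, only up to sign.\<close>

locale pointed_MUB =
  fixes M :: "nat \<Rightarrow> (real ^ 'n) set" and p q :: "real ^ 'n" and i\<^sub>0 :: nat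
    and I :: "nat set" and d :: real
  assumes mub: "maximal_real_MUB M"
    and I_def: "I = {1..CARD('n) div 2 + 1}"
    and d_def: "d = real CARD('n)"
    and i\<^sub>0_I: "i\<^sub>0 \<in> I"
    and q: "q \<in> M i\<^sub>0"
    and p: "p = q \<or> p = - q"
begin

section \<open>Simplices and cross polytope in the complement of the base point\<close>

definition J :: "nat set" where "J = I - {i\<^sub>0}"

text \<open>The length of the component orthogonal to \<open>p\<close> of a unit vector whose inner
  product with \<open>p\<close> is \<open>1 / sqrt d\<close>.\<close>

definition c :: real where "c = sqrt (1 - 1 / d)"

definition P :: "(real ^ 'n) set" where "P = {x. x \<bullet> p = 0}"

text \<open>Picks from each pair of opposite vectors not orthogonal to \<open>p\<close> the one on
  the side of \<open>p\<close>.\<close>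

definition \<sigma> :: "real ^ 'n \<Rightarrow> real ^ 'n" where "\<sigma> x = (if x \<bullet> p > 0 then x else - x)"

definition proj :: "real ^ 'n \<Rightarrow> real ^ 'n" where
  "proj x = (x - (1 / sqrt d) *\<^sub>R p) /\<^sub>R c"

text \<open>An orthonormal basis of \<open>P\<close>, because \<open>p\<close> is \<open>q\<close>
  up to sign.\<close>

definition C :: "(real ^ 'n) set" where "C = M i\<^sub>0 - {q}"

definition G :: "nat \<Rightarrow> (real ^ 'n) set" where "G j = proj ` \<sigma> ` M j"

definition B :: "(real ^ 'n) set" where "B = C \<union> uminus ` C"

text \<open>Evenness excludes dimension one, where \<open>c\<close> would vanish.\<close>

lemma d_ge_2: "d \<ge> 2"
proof -
  have "even CARD('n)" using mub by (simp add: maximal_real_MUB_def)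
  then obtain b where "CARD('n) = 2 * b" by (elim evenE)
  moreover have "CARD('n) > 0" by simp
  ultimately have "CARD('n) \<ge> 2" by (cases b) simp_all
  then show ?thesis by (simp add: d_def)
qed

lemma c_pos: "c > 0" and c_square: "c\<^sup>2 = (d - 1) / d"
  using d_ge_2 by (simp_all add: c_def field_simps)

lemma card_J: "2 * real (card J) = d"
proof -
  have "even CARD('n)" using mub by (simp add: maximal_real_MUB_def)
  moreover have "card J = CARD('n) div 2"
    unfolding J_def card_Diff_singleton[OF i\<^sub>0_I] by (simp add: I_def)
  ultimately have "2 * card J = CARD('n)" by simp
  then show ?thesis unfolding d_def by linarith
qed

lemma onb: "j \<in> I \<Longrightarrow> orthonormal_basis (M j)"
  using mub by (simp add: maximal_real_MUB_def I_def)

lemma J_I: "j \<in> J \<Longrightarrow> j \<in> I"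
  by (simp add: J_def)

lemma unbiased:
  assumes "i \<in> I" "j \<in> I" "i \<noteq> j" "x \<in> M i" "y \<in> M j"
  shows "x \<bullet> y = 1 / sqrt d \<or> x \<bullet> y = - (1 / sqrt d)"
  using mub assms by (force simp: maximal_real_MUB_def I_def d_def)

lemma norm_p: "p \<bullet> p = 1"
  using p orthonormal_basis_inner[OF onb[OF i\<^sub>0_I] q q] by auto

lemma unbiased_p:
  assumes "j \<in> J" "x \<in> M j"
  shows "x \<bullet> p = 1 / sqrt d \<or> x \<bullet> p = - (1 / sqrt d)"
  using unbiased[OF J_I[OF assms(1)] i\<^sub>0_I _ assms(2) q] assms(1) p by (auto simp: J_def)

lemma \<sigma>_cases: "\<sigma> x = x \<or> \<sigma> x = - x"
  by (simp add: \<sigma>_def)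

lemma \<sigma>_p:
  assumes "j \<in> J" "x \<in> M j" shows "\<sigma> x \<bullet> p = 1 / sqrt d"
  using unbiased_p[OF assms] d_ge_2 by (auto simp: \<sigma>_def)

lemma \<sigma>_inner_same:
  assumes "j \<in> I" "x \<in> M j" "y \<in> M j" shows "\<sigma> x \<bullet> \<sigma> y = of_bool (x = y)"
  using orthonormal_basis_inner[OF onb[OF assms(1)] assms(2,3)] \<sigma>_cases[of x] \<sigma>_cases[of y]
  by (auto simp: \<sigma>_def)

lemma \<sigma>_inner_diff:
  assumes "i \<in> I" "j \<in> I" "i \<noteq> j" "x \<in> M i" "y \<in> M j"
  shows "\<sigma> x \<bullet> \<sigma> y = 1 / sqrt d \<or> \<sigma> x \<bullet> \<sigma> y = - (1 / sqrt d)"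
  using unbiased[OF assms] \<sigma>_cases[of x] \<sigma>_cases[of y] by auto

text \<open>The sign occurs twice and cancels, so Parseval survives the flipping of a basis.\<close>

lemma \<sigma>_parseval_term: "(u \<bullet> \<sigma> x) * (\<sigma> x \<bullet> v) = (u \<bullet> x) * (x \<bullet> v)"
  by (simp add: \<sigma>_def)

text \<open>Removing the components along \<open>p\<close> subtracts \<open>1 / d\<close> from the
  inner product; the rescaling divides by \<open>c\<^sup>2\<close>, which is
  \<open>(d - 1) / d\<close>.\<close>

lemma proj_inner:
  assumes "x \<bullet> p = 1 / sqrt d" "y \<bullet> p = 1 / sqrt d"
  shows "(d - 1) * (proj x \<bullet> proj y) = d * (x \<bullet> y) - 1"
proof -
  have "p \<bullet> y = 1 / sqrt d" using assms(2) by (simp add: inner_commute)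
  moreover have "1 / sqrt d * (1 / sqrt d) = 1 / d" using d_ge_2 by simp
  ultimately have "proj x \<bullet> proj y = (x \<bullet> y - 1 / d) / c\<^sup>2"
    using assms norm_p by (simp add: proj_def inner_diff power2_eq_square divide_inverse)
  then have "(d - 1) * (proj x \<bullet> proj y) = d * (x \<bullet> y - 1 / d)"
    using d_ge_2 by (simp add: c_square)
  then show ?thesis using d_ge_2 by (simp add: right_diff_distrib)
qed

lemma proj_inner_P:
  assumes "u \<in> P" shows "u \<bullet> proj x = (u \<bullet> x) / c" "proj x \<bullet> u = (x \<bullet> u) / c"
  using assms by (simp_all add: proj_def P_def inner_diff inner_commute divide_inverse)

lemma proj_P: "x \<bullet> p = 1 / sqrt d \<Longrightarrow> proj x \<in> P"
  by (simp add: P_def proj_def inner_diff norm_p)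

lemma inj_proj: "inj proj"
  using c_pos by (auto simp: inj_on_def proj_def)

lemma inj_\<sigma>:
  assumes "j \<in> I" shows "inj_on \<sigma> (M j)"
proof (rule inj_onI)
  fix x y assume "x \<in> M j" "y \<in> M j" "\<sigma> x = \<sigma> y"
  then show "x = y"
    using \<sigma>_inner_same[OF assms, of x y] \<sigma>_inner_same[OF assms, of x x] by (auto split: if_splits)
qed

lemma inj_proj_\<sigma>: "j \<in> I \<Longrightarrow> inj_on (\<lambda>x. proj (\<sigma> x)) (M j)"
  using comp_inj_on[OF inj_\<sigma> inj_on_subset[OF inj_proj]] by (simp add: o_def)

lemma G_image: "G j = (\<lambda>x. proj (\<sigma> x)) ` M j"
  by (simp add: G_def image_image)

lemma sum_G: "j \<in> I \<Longrightarrow> (\<Sum>z\<in>G j. f z) = (\<Sum>x\<in>M j. f (proj (\<sigma> x)))"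
  by (simp add: G_image sum.reindex[OF inj_proj_\<sigma>])

lemma finite_C: "finite C"
  using orthonormal_basis_finite[OF onb[OF i\<^sub>0_I]] by (simp add: C_def)

lemma C_P: "x \<in> C \<Longrightarrow> x \<in> P"
  using p orthonormal_basis_inner[OF onb[OF i\<^sub>0_I] _ q, of x] by (auto simp: C_def P_def)

lemma C_inner: "x \<in> C \<Longrightarrow> y \<in> C \<Longrightarrow> x \<bullet> y = of_bool (x = y)"
  using orthonormal_basis_inner[OF onb[OF i\<^sub>0_I]] by (simp add: C_def)

text \<open>Opposite vectors have inner product -1, whereas in \<open>C\<close> only 0 and 1
  occur.\<close>

lemma C_disjoint: "C \<inter> uminus ` C = {}"
proof -
  have False if "x \<in> C" "y \<in> C" "x = - y" for x y
  proof -
    have "x \<bullet> y \<ge> 0" "y \<bullet> y = 1"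
      using C_inner[OF that(1,2)] C_inner[OF that(2,2)] by simp_all
    then show False using that(3) by simp
  qed
  then show ?thesis by blast
qed

lemma sum_B: "(\<Sum>z\<in>B. f z) = (\<Sum>z\<in>C. f z) + (\<Sum>z\<in>C. f (- z))"
  unfolding B_def using finite_C C_disjoint
  by (simp add: sum.union_disjoint sum.reindex)

lemma card_C: "real (card C) = d - 1"
  using orthonormal_basis_card[OF onb[OF i\<^sub>0_I]] orthonormal_basis_finite[OF onb[OF i\<^sub>0_I]] q d_ge_2
  by (simp add: C_def of_nat_diff d_def)

section \<open>The frame axioms for a maximal MUB\<close>

sublocale derived_mub_frame P J G B "d - 1"
proof
  show "0 < d - 1" using d_ge_2 by simp
  show "finite J" unfolding J_def by (simp add: I_def)
  show "2 * real (card J) = d - 1 + 1" using card_J by simp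
  show "- x \<in> P" if "x \<in> P" for x using that by (simp add: P_def)
  show "finite (G j)" if "j \<in> J" for j
    using orthonormal_basis_finite[OF onb[OF J_I[OF that]]] by (simp add: G_def)
  show "real (card (G j)) = d - 1 + 1" if "j \<in> J" for j
    using orthonormal_basis_card[OF onb[OF J_I[OF that]]]
    unfolding G_image card_image[OF inj_proj_\<sigma>[OF J_I[OF that]]] by (simp add: d_def)
  show "x \<in> P" if "j \<in> J" "x \<in> G j" for x j
    using that by (auto simp: G_def \<sigma>_p intro!: proj_P)
  show "norm x = 1" if j: "j \<in> J" and x: "x \<in> G j" for x j
  proof -
    obtain y where y: "y \<in> M j" "x = proj (\<sigma> y)" using x by (auto simp: G_def)
    then have "(d - 1) * (x \<bullet> x) = d - 1"
      using proj_inner[OF \<sigma>_p[OF j y(1)] \<sigma>_p[OF j y(1)]] \<sigma>_inner_same[OF J_I[OF j] y(1) y(1)] by simp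
    then show ?thesis using d_ge_2 by (simp add: norm_eq_1)
  qed
  show "(d - 1) * (x \<bullet> y) = - 1" if j: "j \<in> J" and xy: "x \<in> G j" "y \<in> G j" "x \<noteq> y" for x y j
  proof -
    obtain x' y' where *: "x' \<in> M j" "x = proj (\<sigma> x')" "y' \<in> M j" "y = proj (\<sigma> y')"
      using xy by (auto simp: G_def)
    then show ?thesis
      using proj_inner[OF \<sigma>_p[OF j *(1)] \<sigma>_p[OF j *(3)]] \<sigma>_inner_same[OF J_I[OF j] *(1,3)] xy(3) by auto
  qed
  show "((d - 1) * (x \<bullet> y) + 1)\<^sup>2 = d - 1 + 1"
    if ij: "i \<in> J" "j \<in> J" "i \<noteq> j" and xy: "x \<in> G i" "y \<in> G j" for x y i j
  proof -
    obtain x' y' where *: "x' \<in> M i" "x = proj (\<sigma> x')" "y' \<in> M j" "y = proj (\<sigma> y')"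
      using xy by (auto simp: G_def)
    have "((d - 1) * (x \<bullet> y) + 1)\<^sup>2 = (d * (\<sigma> x' \<bullet> \<sigma> y'))\<^sup>2"
      using proj_inner[OF \<sigma>_p[OF ij(1) *(1)] \<sigma>_p[OF ij(2) *(3)]] * by simp
    also have "\<dots> = d\<^sup>2 * (\<sigma> x' \<bullet> \<sigma> y')\<^sup>2"
      by (rule power_mult_distrib)
    also have "(\<sigma> x' \<bullet> \<sigma> y')\<^sup>2 = 1 / d"
      using \<sigma>_inner_diff[OF J_I[OF ij(1)] J_I[OF ij(2)] ij(3) *(1,3)] d_ge_2 by (auto simp: power_divide)
    finally show ?thesis by (simp add: power2_eq_square)
  qed
  show "(\<Sum>z\<in>G j. x \<bullet> z) = 0" if j: "j \<in> J" and x: "x \<in> P" for x j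
  proof -
    \<comment> \<open>The constant 1 is written as \<open>sqrt d * (\<sigma> z \<bullet> p)\<close>,
      which turns the first moment into a Parseval sum with value a multiple of
      \<open>x \<bullet> p\<close>.\<close>
    have "(\<Sum>z\<in>G j. x \<bullet> z) = (\<Sum>z\<in>M j. sqrt d / c * ((x \<bullet> \<sigma> z) * (\<sigma> z \<bullet> p)))"
      unfolding sum_G[OF J_I[OF j]] using d_ge_2 j
      by (intro sum.cong refl) (simp add: proj_inner_P x \<sigma>_p)
    also have "\<dots> = sqrt d / c * (x \<bullet> p)"
      by (simp only: \<sigma>_parseval_term orthonormal_basis_parseval[OF onb[OF J_I[OF j]]] flip: sum_distrib_left)
    finally show ?thesis using x by (simp add: P_def)
  qed
  show "(\<Sum>z\<in>G j. (x \<bullet> z) * (z \<bullet> y)) = (d - 1 + 1) / (d - 1) * (x \<bullet> y)"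
    if j: "j \<in> J" and xy: "x \<in> P" "y \<in> P" for x y j
  proof -
    have "(\<Sum>z\<in>G j. (x \<bullet> z) * (z \<bullet> y)) = (\<Sum>z\<in>M j. 1 / c\<^sup>2 * ((x \<bullet> \<sigma> z) * (\<sigma> z \<bullet> y)))"
      unfolding sum_G[OF J_I[OF j]]
      by (intro sum.cong refl) (simp add: proj_inner_P xy power2_eq_square)
    also have "\<dots> = 1 / c\<^sup>2 * (x \<bullet> y)"
      by (simp only: \<sigma>_parseval_term orthonormal_basis_parseval[OF onb[OF J_I[OF j]]] flip: sum_distrib_left)
    finally show ?thesis by (simp add: c_square)
  qed
  show "finite B" using finite_C by (simp add: B_def)
  show "real (card B) = 2 * (d - 1)"
    using sum_B[of "\<lambda>_. 1 :: real"] card_C by simp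
  show "x \<in> P" if "x \<in> B" for x
    using that C_P by (auto simp: B_def P_def)
  show "norm x = 1" if "x \<in> B" for x
    using that C_inner by (auto simp: B_def norm_eq_1)
  show "- x \<in> B" if "x \<in> B" for x
    using that by (auto simp: B_def)
  show "x \<bullet> y = 0" if "x \<in> B" "y \<in> B" "x \<noteq> y" "x \<noteq> - y" for x y
    using that C_inner by (fastforce simp: B_def)
  show "(\<Sum>z\<in>B. (x \<bullet> z) * (z \<bullet> y)) = 2 * (x \<bullet> y)" if xy: "x \<in> P" "y \<in> P" for x y
  proof -
    \<comment> \<open>Dropping \<open>q\<close> from the Parseval sum changes nothing, as
      \<open>x\<close> and \<open>y\<close> are orthogonal to it.\<close>
    have "(\<Sum>z\<in>C. (x \<bullet> z) * (z \<bullet> y)) = (\<Sum>z\<in>M i\<^sub>0. (x \<bullet> z) * (z \<bullet> y)) - (x \<bullet> q) * (q \<bullet> y)"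
      unfolding C_def using orthonormal_basis_finite[OF onb[OF i\<^sub>0_I]] q by (simp add: sum_diff1)
    also have "\<dots> = x \<bullet> y"
      using orthonormal_basis_parseval[OF onb[OF i\<^sub>0_I]] xy p by (auto simp: P_def)
    finally show ?thesis by (simp add: sum_B)
  qed
  show "(d - 1) * (x \<bullet> y)\<^sup>2 = 1" if j: "j \<in> J" and xy: "x \<in> B" "y \<in> G j" for x y j
  proof -
    obtain z where z: "z \<in> M j" "y = proj (\<sigma> z)" using xy by (auto simp: G_def)
    obtain x' where x': "x' \<in> M i\<^sub>0" "x = x' \<or> x = - x'" using xy by (auto simp: B_def C_def)
    have "x \<in> P" using xy(1) C_P by (auto simp: B_def P_def)
    then have "(x \<bullet> y)\<^sup>2 = (x' \<bullet> z)\<^sup>2 / c\<^sup>2"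
      using z x' \<sigma>_cases[of z] by (auto simp: proj_inner_P power_divide)
    also have "(x' \<bullet> z)\<^sup>2 = 1 / d"
      using unbiased[OF i\<^sub>0_I J_I[OF j] _ x'(1) z(1)] j d_ge_2 by (auto simp: J_def power_divide)
    finally show ?thesis using d_ge_2 by (simp add: c_square)
  qed
qed

section \<open>Identification of the derived codes\<close>

lemma mem_MUB_code: "x \<in> MUB_code M \<longleftrightarrow> (\<exists>j\<in>I. \<exists>y\<in>M j. x = y \<or> x = - y)"
  by (auto simp: MUB_code_def I_def)

lemma inner_p_i\<^sub>0: "x \<in> M i\<^sub>0 \<Longrightarrow> x \<bullet> p = 0 \<or> x \<bullet> p = 1 \<or> x \<bullet> p = - 1"
  using p orthonormal_basis_inner[OF onb[OF i\<^sub>0_I] _ q, of x] by auto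

lemma sqrt_d: "0 < 1 / sqrt d" "1 / sqrt d < 1"
  using d_ge_2 by simp_all

text \<open>The basis containing \<open>q\<close> has inner products 0, 1 or -1 with
  \<open>p\<close>, and \<open>1 / sqrt d\<close> lies strictly between 0 and 1; every other basis
  contributes its vectors flipped towards \<open>p\<close>.\<close>

lemma MUB_code_positive: "{x \<in> MUB_code M. x \<bullet> p = 1 / sqrt d} = (\<Union>j\<in>J. \<sigma> ` M j)"
proof (intro equalityI subsetI)
  fix x assume "x \<in> {x \<in> MUB_code M. x \<bullet> p = 1 / sqrt d}"
  then obtain j y where *: "j \<in> I" "y \<in> M j" "x = y \<or> x = - y" "x \<bullet> p = 1 / sqrt d"
    by (auto simp: mem_MUB_code)
  have "j \<noteq> i\<^sub>0"
  proof
    assume "j = i\<^sub>0"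
    then have "y \<bullet> p = 0 \<or> y \<bullet> p = 1 \<or> y \<bullet> p = - 1" using * inner_p_i\<^sub>0 by blast
    then have "x \<bullet> p = 0 \<or> x \<bullet> p = 1 \<or> x \<bullet> p = - 1" using * by auto
    then show False unfolding *(4) using sqrt_d by linarith
  qed
  then have "j \<in> J" using * by (simp add: J_def)
  moreover have "x \<bullet> p > 0" using *(4) sqrt_d(1) by simp
  then have "x = \<sigma> y" using *(3) by (auto simp: \<sigma>_def)
  ultimately show "x \<in> (\<Union>j\<in>J. \<sigma> ` M j)" using * by blast
next
  fix x assume "x \<in> (\<Union>j\<in>J. \<sigma> ` M j)"
  then obtain j y where *: "j \<in> J" "y \<in> M j" "x = \<sigma> y" by blast
  then show "x \<in> {x \<in> MUB_code M. x \<bullet> p = 1 / sqrt d}"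
    using \<sigma>_p[OF *(1,2)] \<sigma>_cases[of y] J_I[OF *(1)] by (auto simp: mem_MUB_code)
qed

lemma MUB_code_orthogonal: "{x \<in> MUB_code M. x \<bullet> p = 0} = B"
proof (intro equalityI subsetI)
  fix x assume "x \<in> {x \<in> MUB_code M. x \<bullet> p = 0}"
  then obtain j y where *: "j \<in> I" "y \<in> M j" "x = y \<or> x = - y" "x \<bullet> p = 0"
    by (auto simp: mem_MUB_code)
  then have y: "y \<bullet> p = 0" by auto
  have "j = i\<^sub>0"
  proof (rule ccontr)
    assume "j \<noteq> i\<^sub>0"
    then show False using unbiased_p[of j y] * y sqrt_d by (auto simp: J_def)
  qed
  moreover have "y \<noteq> q" using y p norm_p by auto
  ultimately show "x \<in> B" using * by (auto simp: B_def C_def)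
next
  fix x assume "x \<in> B"
  then show "x \<in> {x \<in> MUB_code M. x \<bullet> p = 0}"
    using B_P[of x] i\<^sub>0_I by (auto simp: B_def C_def P_def mem_MUB_code)
qed

lemma MUB_code_negative: "{x \<in> MUB_code M. x \<bullet> p = - (1 / sqrt d)} = uminus ` {x \<in> MUB_code M. x \<bullet> p = 1 / sqrt d}"
proof -
  have "- x \<in> MUB_code M" if "x \<in> MUB_code M" for x
    using that unfolding mem_MUB_code by (metis minus_minus)
  then have *: "- x \<in> {x \<in> MUB_code M. x \<bullet> p = - a}" if "x \<in> {x \<in> MUB_code M. x \<bullet> p = a}" for x a
    using that by simp
  show ?thesis
    using *[where a = "1 / sqrt d"] *[where a = "- (1 / sqrt d)"]
    by (intro equalityI subsetI image_eqI[where f = uminus, OF minus_minus[symmetric]]) auto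
qed

lemma derived_code_image: "derived_code X p a = (\<lambda>x. (x - a *\<^sub>R p) /\<^sub>R sqrt (1 - a\<^sup>2)) ` {x \<in> X. x \<bullet> p = a}"
  by (auto simp: derived_code_def)

lemma derived_code_1: "derived_code (MUB_code M) p (1 / sqrt d) = code 1"
proof -
  have "(1 / sqrt d)\<^sup>2 = 1 / d" using d_ge_2 by (simp add: power_divide)
  then have "derived_code (MUB_code M) p (1 / sqrt d) = proj ` {x \<in> MUB_code M. x \<bullet> p = 1 / sqrt d}"
    unfolding derived_code_image by (intro image_cong refl) (simp only: proj_def c_def)
  then show ?thesis
    by (simp only: MUB_code_positive code_def N_def G_def image_UN) simp
qed

lemma derived_code_2: "derived_code (MUB_code M) p 0 = code 2"
  by (simp add: derived_code_image MUB_code_orthogonal code_B)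

lemma derived_code_3: "derived_code (MUB_code M) p (- (1 / sqrt d)) = code 3"
proof -
  have "(- (1 / sqrt d))\<^sup>2 = 1 / d" using d_ge_2 by (simp add: power_divide)
  then have "derived_code (MUB_code M) p (- (1 / sqrt d)) =
      (\<lambda>x. (x - (- (1 / sqrt d)) *\<^sub>R p) /\<^sub>R c) ` uminus ` {x \<in> MUB_code M. x \<bullet> p = 1 / sqrt d}"
    by (simp only: derived_code_image MUB_code_negative c_def)
  \<comment> \<open>For a negated point the component along \<open>p\<close> is added back, so the
    overall sign can be pulled out of the projection.\<close>
  also have "\<dots> = (\<lambda>x. - proj x) ` {x \<in> MUB_code M. x \<bullet> p = 1 / sqrt d}"
    by (simp add: image_image proj_def algebra_simps)
  also have "\<dots> = code 3"
    by (simp add: MUB_code_positive code_def N_def G_def image_UN image_image)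
  finally show ?thesis .
qed

end

section \<open>Transfer to the given family of codes\<close>

lemma tagged_union_cong: "(\<And>k. k \<in> K \<Longrightarrow> X k = X' k) \<Longrightarrow> tagged_union K X = tagged_union K X'"
  by (simp add: tagged_union_def cong: Sigma_cong)

text \<open>Needed because \<open>Xd\<close> is determined only on \<open>{1, 2, 3}\<close>. The
  inclusion is shown for arbitrary families and applied in both directions.\<close>

lemma inner_rels_cong:
  assumes "\<And>k. k \<in> K \<Longrightarrow> X k = X' k" shows "inner_rels K X = inner_rels K X'"
proof -
  have "inner_rels K A \<subseteq> inner_rels K A'" if eq: "\<And>k. k \<in> K \<Longrightarrow> A k = A' k"
    for A A' :: "'a \<Rightarrow> 'b set"
  proof
    fix R assume "R \<in> inner_rels K A"
    then consider i where "i \<in> K" "R = {((i, x), (i, x)) | x. x \<in> A i}"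
      | i j x y where "i \<in> K" "j \<in> K" "x \<in> A i" "y \<in> A j" "(i, x) \<noteq> (j, y)"
          "R = inner_rel A i j (x \<bullet> y)"
      unfolding inner_rels_def by blast
    then show "R \<in> inner_rels K A'"
    proof cases
      case 1
      then show ?thesis unfolding inner_rels_def using eq by blast
    next
      case 2
      have "R = inner_rel A' i j (x \<bullet> y)"
        unfolding 2(6) inner_rel_def eq[OF 2(1)] eq[OF 2(2)] ..
      then show ?thesis
        unfolding inner_rels_def using 2(1-5) unfolding eq[OF 2(1)] eq[OF 2(2)] by blast
    qed
  qed
  then show ?thesis using assms by (metis subset_antisym)
qed

theorem theorem5p12:
  fixes M :: "nat \<Rightarrow> (real ^ 'n) set" and p :: "real ^ 'n"
    and \<alpha> :: "nat \<Rightarrow> real" and Xd :: "nat \<Rightarrow> (real ^ 'n) set"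
  assumes "maximal_real_MUB M"
    and "p \<in> MUB_code M"
    and "\<alpha> 1 = 1 / sqrt CARD('n)" and "\<alpha> 2 = 0" and "\<alpha> 3 = - 1 / sqrt CARD('n)"
    and "\<And>k. k \<in> {1, 2, 3} \<Longrightarrow> Xd k = derived_code (MUB_code M) p (\<alpha> k)"
  shows "Q_polynomial_coherent_configuration
           (tagged_union {1, 2, 3} Xd) (inner_rels {1, 2, 3} Xd)"
proof -
  obtain i q where "i \<in> {1..CARD('n) div 2 + 1}" "q \<in> M i" "p = q \<or> p = - q"
    using assms(2) by (auto simp: MUB_code_def)
  then interpret pointed_MUB M p q i "{1..CARD('n) div 2 + 1}" "real CARD('n)"
    using assms(1) by unfold_locales simp_all
  have Xd: "Xd k = code k" if k: "k \<in> {1, 2, 3}" for k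
  proof -
    consider "k = 1" | "k = 2" | "k = 3" using k by blast
    then show ?thesis
      using assms(6)[OF k] assms(3-5) derived_code_1 derived_code_2 derived_code_3 by cases simp_all
  qed
  have "tagged_union {1, 2, 3} Xd = tagged_union {1, 2, 3} code"
    by (rule tagged_union_cong) (rule Xd)
  moreover have "inner_rels {1, 2, 3} Xd = inner_rels {1, 2, 3} code"
    by (rule inner_rels_cong) (rule Xd)
  ultimately show ?thesis using Q_polynomial by (simp only:)
qed

end
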